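(* Let $n\ge t\ge 1$ be integers. Then $$M(n,t)=\max_{0\le r\le \lfloor (n-t)/2\rfloor}\Bigl|\bigl\{p\in\Pi(n):\ \bigl|[t+2r]\cap f(p)\bigr|\ge t+r\bigr\}\Bigr|,$$ where $r$ ranges over integers.
   Context: $[m]=\{1,\dots,m\}$. $\Pi(n)$ is the set of all set partitions of $[n]$; the parts (blocks) of a partition are nonempty. For $p_1,p_2\in\Pi(n)$ the intersection $p_1\cap p_2$ is the set of common blocks of $p_1$ and $p_2$. A family $\mathcal A\subseteq\Pi(n)$ is $t$-intersecting if $|p_1\cap p_2|\ge t$ for all $p_1,p_2\in\mathcal A$. $M(n,t)$ is the maximum size $|\mathcal A|$ of a $t$-intersecting family $\mathcal A\subseteq \Pi(n)$. For $p\in\Pi(n)$, $f(p)=\{i\in[n]:\{i\}\text{ is a block of }p\}$ is the set of points fixed by $p$. *)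

theory Defs
  imports Main "HOL-Library.Disjoint_Sets"
begin

definition set_partitions :: "nat \<Rightarrow> nat set set set" where
  "set_partitions n = {p. partition_on {1..n} p}"

(* The two partitions may be equal, so every member of the family has at least t blocks. *)
definition t_intersecting :: "nat \<Rightarrow> nat set set set \<Rightarrow> bool" where
  "t_intersecting t \<A> \<longleftrightarrow> (\<forall>p\<in>\<A>. \<forall>q\<in>\<A>. card (p \<inter> q) \<ge> t)"

(* The set of sizes is finite and nonempty (the empty family is t-intersecting), so Max is proper. *)
definition max_intersecting :: "nat \<Rightarrow> nat \<Rightarrow> nat" where
  "max_intersecting n t = Max {card \<A> | \<A>. \<A> \<subseteq> set_partitions n \<and> t_intersecting t \<A>}"

definition fixed_points :: "nat \<Rightarrow> nat set set \<Rightarrow> nat set" where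
  "fixed_points n p = {i \<in> {1..n}. {i} \<in> p}"

end

theory Submission
  imports Defs Complex_Main "HOL-Combinatorics.Stirling"
begin

text \<open>
  Splitting a point off its block whenever this leads outside the family makes every intersection
  visible in the fixed points: the sets \<open>f(p)\<close> then form a \<open>t\<close>-intersecting family, in which a set \<open>S\<close>
  is weighted by the number of partitions whose set of fixed points is \<open>S\<close>.

  Let \<open>W(m)\<close> be the maximal weight of a \<open>t\<close>-intersecting family depending only on the first \<open>m\<close>
  coordinates, and let \<open>\<Phi>(r)\<close> be the weight of the \<open>r\<close>-th candidate. For a left-shifted upset consider the
  sets that leave the family when the coordinate \<open>m\<close> is deleted. Two of them conflict after the deletion
  only if together they cover everything, which pairs their sizes. Keeping one of two different paired
  sizes never loses weight, and in the self-paired size (where \<open>m = t + 2r\<close>) one keeps the sets missing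
  a suitable point; averaging over that point gives \<open>W(m) \<le> W(m - 1) + max(0, \<Phi>(r) - \<Phi>(r - 1))\<close>.
  The sequence \<open>\<Phi>\<close> first increases and then decreases, by log-concavity and log-convexity of
  the Bell numbers and their relatives; hence \<open>W(n) = max \<Phi>\<close>. The single exception \<open>n = 6\<close>, \<open>t = 2\<close>
  is settled by the integrality of the bound.
\<close>

subsection \<open>Partitions without singletons and Bell numbers\<close>

text \<open>The two arguments of \<open>semifree\<close> are what lets the induction on the number
  of coordinates close. A deleted coordinate becomes a free point, which forms a singleton block or
  does not; these are the two terms of \<open>semifree j (Suc q)\<close>. A set kept after a
  deletion thus gains \<open>semifree (Suc j) q\<close>, and this gain has to pay for the sets that
  are dropped. It suffices because \<open>semifree\<close> grows with \<open>j\<close>, except that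
  \<open>sfree 0 = 1\<close> exceeds \<open>sfree 1 = 0\<close>; there only the full set is
  concerned, and if it leaves the family, no other set does.

  The bound for one deletion is an equality for consecutive candidates, since then the self-paired
  size is complete. The positive increments therefore add up to a candidate only if the increments
  never turn positive again after a drop. Their signs are governed by ratios of consecutive
  \<open>semifree\<close> values, which must be controlled from both sides. At the last step no free
  point remains and the numbers \<open>sfree\<close> are not log-convex, so that step needs its own
  estimate. For \<open>n = 6\<close>, \<open>t = 2\<close> the summed increments would only give 17
  instead of 16.\<close>

declare sum.cong [fundef_cong]

text \<open>\<open>sfree n\<close> counts the partitions of \<open>n\<close> points without singleton blocks, and \<open>semifree j q\<close> the
  partitions of \<open>j + q\<close> points in which none of \<open>j\<close> designated points forms a singleton block.\<close>

fun sfree :: "nat \<Rightarrow> nat" where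
  "sfree 0 = 1"
| "sfree (Suc n) = (\<Sum>k<n. (n choose k) * sfree k)"

declare sum.cong [fundef_cong del]
declare sfree.simps(2) [simp del]

fun semifree :: "nat \<Rightarrow> nat \<Rightarrow> nat" where
  "semifree j 0 = sfree j"
| "semifree j (Suc q) = semifree j q + semifree (Suc j) q"

text \<open>The number of all partitions of \<open>n\<close> points: merging all singleton blocks
  with one added point turns the partitions that have singletons into the singleton-free partitions
  of \<open>n + 1\<close> points.\<close>

definition bell :: "nat \<Rightarrow> nat" where
  "bell n = sfree n + sfree (Suc n)"

lemma semifree_1: "semifree n (Suc 0) = bell n"
  by (simp add: bell_def)

lemma bell_binomial_sfree: "bell n = (\<Sum>k\<le>n. (n choose k) * sfree k)"
  by (simp add: bell_def sfree.simps(2) lessThan_Suc_atMost[symmetric])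

lemma sum_choose_Suc:
  fixes f :: "nat \<Rightarrow> nat"
  shows "(\<Sum>k\<le>Suc n. (Suc n choose k) * f k) = (\<Sum>k\<le>n. (n choose k) * (f k + f (Suc k)))"
proof -
  have "(\<Sum>k\<le>Suc n. (Suc n choose k) * f k) = f 0 + (\<Sum>k\<le>n. (Suc n choose Suc k) * f (Suc k))"
    by (simp add: sum.atMost_Suc_shift del: binomial_Suc_Suc sum.atMost_Suc)
  also have "\<dots> = (f 0 + (\<Sum>k\<le>n. (n choose Suc k) * f (Suc k))) + (\<Sum>k\<le>n. (n choose k) * f (Suc k))"
    by (simp add: sum.distrib algebra_simps)
  also have "f 0 + (\<Sum>k\<le>n. (n choose Suc k) * f (Suc k)) = (\<Sum>k\<le>Suc n. (n choose k) * f k)"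
    by (simp add: sum.atMost_Suc_shift del: sum.atMost_Suc)
  also have "\<dots> = (\<Sum>k\<le>n. (n choose k) * f k)" by simp
  finally show ?thesis by (simp add: sum.distrib algebra_simps)
qed

lemma bell_Suc: "bell (Suc n) = (\<Sum>k\<le>n. (n choose k) * bell k)"
  by (simp only: bell_binomial_sfree[of "Suc n"] sum_choose_Suc) (simp add: bell_def)

lemma bell_0 [simp]: "bell 0 = 1"
  by (simp add: bell_def sfree.simps(2))

lemma bell_pos: "bell n > 0"
proof (cases n)
  case (Suc m)
  have "bell 0 * (m choose 0) \<le> (\<Sum>k\<le>m. (m choose k) * bell k)"
    by (rule order_trans[OF _ member_le_sum[of 0]]) auto
  then show ?thesis using Suc by (simp add: bell_Suc)
qed simp

text \<open>Here \<open>i\<close> is the number of points outside the block of the added point.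
  Summed over \<open>k\<close>, this becomes the recursion of \<open>bell\<close>.\<close>

lemma Stirling_Suc_binomial: "Stirling (Suc n) (Suc k) = (\<Sum>i\<le>n. (n choose i) * Stirling i k)"
proof (induction n arbitrary: k)
  case 0
  then show ?case by simp
next
  case (Suc n)
  show ?case
  proof (cases k)
    case 0
    then show ?thesis
      by (simp add: sum.atMost_Suc_shift del: sum.atMost_Suc binomial_Suc_Suc Stirling.simps(4))
  next
    case (Suc l)
    have "(\<Sum>i\<le>Suc n. (Suc n choose i) * Stirling i k)
        = (\<Sum>i\<le>n. (n choose i) * Stirling i k) + (\<Sum>i\<le>n. (n choose i) * Stirling (Suc i) k)"
      by (simp only: sum_choose_Suc sum.distrib distrib_left)
    also have "(\<Sum>i\<le>n. (n choose i) * Stirling (Suc i) k)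
        = k * (\<Sum>i\<le>n. (n choose i) * Stirling i k) + (\<Sum>i\<le>n. (n choose i) * Stirling i l)"
      by (simp add: Suc sum.distrib sum_distrib_left algebra_simps)
    finally show ?thesis
      using Suc.IH[of k] Suc.IH[of l] Suc by simp
  qed
qed

lemma sum_Stirling: "(\<Sum>k\<le>n. Stirling n k) = bell n"
proof (induction n rule: less_induct)
  case (less n)
  show ?case
  proof (cases n)
    case (Suc m)
    have "(\<Sum>k\<le>n. Stirling n k) = (\<Sum>k\<le>m. \<Sum>i\<le>m. (m choose i) * Stirling i k)"
      by (simp add: Suc sum.atMost_Suc_shift Stirling_Suc_binomial del: sum.atMost_Suc Stirling.simps(4))
    also have "\<dots> = (\<Sum>i\<le>m. (m choose i) * (\<Sum>k\<le>m. Stirling i k))"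
      by (subst sum.swap) (simp add: sum_distrib_left)
    also have "\<dots> = (\<Sum>i\<le>m. (m choose i) * bell i)"
    proof (intro sum.cong refl)
      fix i assume "i \<in> {..m}"
      then have "(\<Sum>k\<le>m. Stirling i k) = (\<Sum>k\<le>i. Stirling i k)"
        by (intro sum.mono_neutral_right) auto
      then show "(m choose i) * (\<Sum>k\<le>m. Stirling i k) = (m choose i) * bell i"
        using less.IH[of i] \<open>i \<in> {..m}\<close> Suc by simp
    qed
    finally show ?thesis by (simp add: Suc bell_Suc)
  qed simp
qed

text \<open>An added point joins one of the \<open>k\<close> blocks or opens a new one. The free
  weight \<open>f\<close> of the number of blocks gives access to first and second moments.\<close>

lemma sum_Stirling_Suc:
  fixes f :: "nat \<Rightarrow> nat"
  shows "(\<Sum>k\<le>Suc n. f k * Stirling (Suc n) k) = (\<Sum>k\<le>n. (k * f k + f (Suc k)) * Stirling n k)"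
proof -
  have "(\<Sum>k\<le>Suc n. f k * Stirling (Suc n) k)
      = (\<Sum>k\<le>n. Suc k * f (Suc k) * Stirling n (Suc k)) + (\<Sum>k\<le>n. f (Suc k) * Stirling n k)"
    by (simp add: sum.atMost_Suc_shift sum.distrib algebra_simps del: sum.atMost_Suc)
  also have "(\<Sum>k\<le>n. Suc k * f (Suc k) * Stirling n (Suc k)) = (\<Sum>k\<le>Suc n. k * f k * Stirling n k)"
    by (simp add: sum.atMost_Suc_shift del: sum.atMost_Suc)
  finally show ?thesis by (simp add: sum.distrib algebra_simps)
qed

text \<open>Adding a point to a partition with \<open>k\<close> blocks gives \<open>k + 1\<close> partitions, adding two points gives
  \<open>(k + 1)\<^sup>2 + 1\<close>; Cauchy--Schwarz does the rest.\<close>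

lemma bell_log_convex: "bell (Suc n) ^ 2 + bell n ^ 2 \<le> bell n * bell (Suc (Suc n))"
proof -
  let ?S = "\<lambda>k. real (Stirling n k)"
  have 0: "real (bell n) = (\<Sum>k\<le>n. ?S k)"
    by (simp add: sum_Stirling[symmetric])
  have 1: "real (bell (Suc n)) = (\<Sum>k\<le>n. real (Suc k) * ?S k)"
    using arg_cong[OF sum_Stirling_Suc[of "\<lambda>_. 1" n], of real] sum_Stirling[of "Suc n"]
    by (simp del: sum.atMost_Suc add: algebra_simps)
  have 2: "real (bell (Suc (Suc n))) = (\<Sum>k\<le>n. (real (Suc k) ^ 2 + 1) * ?S k)"
    using arg_cong[OF sum_Stirling_Suc[of "\<lambda>_. 1" "Suc n"], of real] sum_Stirling[of "Suc (Suc n)"]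
      arg_cong[OF sum_Stirling_Suc[of Suc n], of real]
    by (simp del: sum.atMost_Suc add: algebra_simps power2_eq_square)
  let ?a = "real (bell n)" and ?b = "real (bell (Suc n))"
  \<comment> \<open>A variance up to the factor \<open>?a ^ 2\<close>: under the weights
    \<open>?S k\<close> of total \<open>?a\<close>, the mean of \<open>Suc k\<close> is
    \<open>?b / ?a\<close>.\<close>
  have "0 \<le> (\<Sum>k\<le>n. (?b - ?a * real (Suc k)) ^ 2 * ?S k)"
    by (intro sum_nonneg) simp
  also have "\<dots> = ?b ^ 2 * (\<Sum>k\<le>n. ?S k) - 2 * ?a * ?b * (\<Sum>k\<le>n. real (Suc k) * ?S k)
      + ?a ^ 2 * (\<Sum>k\<le>n. real (Suc k) ^ 2 * ?S k)"
    by (simp add: sum_distrib_left sum.distrib[symmetric] sum_subtractf[symmetric]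
        algebra_simps power2_eq_square del: of_nat_Suc)
  also have "\<dots> = ?a * (?a * (\<Sum>k\<le>n. real (Suc k) ^ 2 * ?S k) - ?b ^ 2)"
    unfolding 0[symmetric] 1[symmetric] by (simp add: algebra_simps power2_eq_square)
  finally have "?b ^ 2 \<le> ?a * (\<Sum>k\<le>n. real (Suc k) ^ 2 * ?S k)"
    using bell_pos[of n] by (simp add: zero_le_mult_iff)
  also have "(\<Sum>k\<le>n. real (Suc k) ^ 2 * ?S k) = real (bell (Suc (Suc n))) - real (bell n)"
    by (simp add: 0 2 sum.distrib algebra_simps)
  finally have "real (bell (Suc n) ^ 2 + bell n ^ 2) \<le> real (bell n * bell (Suc (Suc n)))"
    by (simp add: algebra_simps power2_eq_square)
  then show ?thesis by linarith
qed

text \<open>Only the two last terms of the recursion are kept, that is, the partitions in which the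
  added point lies in a block of at most two points.\<close>

lemma bell_ge: "bell n + n * bell (n - 1) \<le> bell (Suc n)"
proof (cases n)
  case (Suc m)
  have "(\<Sum>k\<in>{m, Suc m}. (Suc m choose k) * bell k) \<le> (\<Sum>k\<le>Suc m. (Suc m choose k) * bell k)"
    by (rule sum_mono2) auto
  then show ?thesis by (simp only: Suc bell_Suc[of "Suc m"]) simp
qed (simp add: bell_Suc)

lemma bell_mono: "bell n \<le> bell (Suc n)"
  using bell_ge[of n] by simp

text \<open>By log-convexity \<open>n * bell n ^ 2\<close> is at most
  \<open>n * bell (n - 1) * bell (Suc n)\<close>, and \<open>bell_ge\<close> absorbs the factor
  \<open>n * bell (n - 1)\<close>.\<close>

lemma Suc_bell_square_le: "Suc n * bell n ^ 2 \<le> bell (Suc n) ^ 2"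
proof (cases n)
  case (Suc m)
  have "Suc n * bell n ^ 2 = bell n * bell n + n * bell n ^ 2"
    by (simp add: power2_eq_square)
  also have "\<dots> \<le> bell n * bell (Suc n) + n * (bell m * bell (Suc n))"
    unfolding Suc using bell_log_convex[of m] bell_mono[of "Suc m"]
    by (intro add_mono mult_left_mono) linarith+
  also have "\<dots> = (bell n + n * bell m) * bell (Suc n)"
    by (simp add: algebra_simps)
  also have "\<dots> \<le> bell (Suc n) * bell (Suc n)"
    using bell_ge[of n] Suc by (intro mult_right_mono) auto
  finally show ?thesis by (simp add: power2_eq_square)
qed (simp add: bell_Suc)

section \<open>Log-concavity of the Bell numbers divided by factorials\<close>

text \<open>The weights \<open>b i * p i\<close> favour large indices more than
  \<open>a i * p i\<close> do, so the increasing \<open>w\<close> has the larger mean under them.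
  Symmetrising in \<open>i\<close> and \<open>j\<close> leaves products of two factors of equal
  sign.\<close>

lemma chebyshev_double_sum:
  fixes p w a b :: "nat \<Rightarrow> real"
  assumes "\<And>i. i < N \<Longrightarrow> p i \<ge> 0"
    and "\<And>i j. j \<le> i \<Longrightarrow> i < N \<Longrightarrow> w j \<le> w i"
    and "\<And>i j. j \<le> i \<Longrightarrow> i < N \<Longrightarrow> a i * b j \<le> b i * a j"
  shows "(\<Sum>i<N. a i * p i * w i) * (\<Sum>i<N. b i * p i) \<le> (\<Sum>i<N. b i * p i * w i) * (\<Sum>i<N. a i * p i)"
proof -
  let ?f = "\<lambda>i j. p i * p j * w i * (b i * a j - a i * b j)"
  have eq: "(\<Sum>i<N. b i * p i * w i) * (\<Sum>i<N. a i * p i)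
      - (\<Sum>i<N. a i * p i * w i) * (\<Sum>i<N. b i * p i) = (\<Sum>i<N. \<Sum>j<N. ?f i j)"
    unfolding sum_product sum_subtractf[symmetric] by (intro sum.cong refl) (simp add: algebra_simps)
  have "2 * (\<Sum>i<N. \<Sum>j<N. ?f i j) = (\<Sum>i<N. \<Sum>j<N. ?f i j) + (\<Sum>i<N. \<Sum>j<N. ?f j i)"
    by (subst (2) sum.swap) simp
  also have "\<dots> = (\<Sum>i<N. \<Sum>j<N. p i * p j * ((w i - w j) * (b i * a j - a i * b j)))"
    by (simp add: sum.distrib[symmetric] algebra_simps)
  also have "\<dots> \<ge> 0"
  proof (intro sum_nonneg)
    fix i j assume ij: "i \<in> {..<N}" "j \<in> {..<N}"
    have "0 \<le> (w i - w j) * (b i * a j - a i * b j)"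
    proof (cases "j \<le> i")
      case True
      then show ?thesis using assms(2,3)[of j i] ij by simp
    next
      case False
      then show ?thesis using assms(2,3)[of i j] ij
        by (intro mult_nonpos_nonpos) (simp_all add: algebra_simps)
    qed
    then show "0 \<le> p i * p j * ((w i - w j) * (b i * a j - a i * b j))"
      using assms(1) ij by simp
  qed
  finally show ?thesis using eq by simp
qed

text \<open>The logarithmic derivative of the exponential generating function has coefficients \<open>1 / k!\<close>;
  log-concavity of the coefficients \<open>A n\<close> propagates through the resulting recursion by a
  Chebyshev-type correlation inequality (cf. Bender and Canfield).\<close>

lemma exp_exp_log_concave:
  fixes A :: "nat \<Rightarrow> real"
  assumes pos: "\<And>n. A n > 0"
    and rec: "\<And>n. real (Suc n) * A (Suc n) = (\<Sum>i\<le>n. A i / fact (n - i))"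
  shows "A n * A (Suc (Suc n)) \<le> A (Suc n) ^ 2"
proof (induction n rule: less_induct)
  case (less n)
  show ?case
  proof (cases n)
    case 0
    then show ?thesis using rec[of 0] rec[of 1] by (simp add: power2_eq_square)
  next
    case (Suc m)
    have "(\<Sum>i\<le>m. A i / fact (Suc m - i)) \<le> (\<Sum>i\<le>m. A i / fact (m - i))"
      by (intro sum_mono divide_left_mono fact_mono mult_pos_pos) (auto intro: less_imp_le[OF pos])
    then have "real (Suc (Suc m)) * A (Suc n) \<le> real (Suc (Suc m)) * A n"
      using rec[of m] rec[of n] by (simp add: Suc algebra_simps)
    then have dec: "A (Suc n) \<le> A n"
      by (simp add: mult_le_cancel_left)
    \<comment> \<open>\<open>b\<close> is \<open>A\<close> shifted by one place with 0 in front, and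
      the factor \<open>w i\<close> turns \<open>1 / (n - i)!\<close> into
      \<open>1 / (n + 1 - i)!\<close>. Hence the sums \<open>S1\<close> to \<open>S4\<close> are all
      instances of the recursion, the last two without their final term.\<close>
    define b where "b i = (case i of 0 \<Rightarrow> 0 | Suc j \<Rightarrow> A j)" for i
    define p :: "nat \<Rightarrow> real" where "p i = 1 / fact (n - i)" for i
    define w :: "nat \<Rightarrow> real" where "w i = 1 / real (Suc n - i)" for i
    have ratio: "A (Suc i) * A j \<le> A i * A (Suc j)" if "j \<le> i" "i \<le> n" for i j
      using that
    proof (induction i rule: dec_induct)
      case (step k)
      have "A k * (A (Suc (Suc k)) * A j) \<le> A (Suc k) * (A (Suc k) * A j)"
        using less.IH[of k] step.prems pos[of j] by (simp add: power2_eq_square algebra_simps)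
      also have "\<dots> \<le> A (Suc k) * (A k * A (Suc j))"
        using step pos[of "Suc k"] by (intro mult_left_mono) (auto intro: less_imp_le)
      finally show ?case using pos[of k] by (simp add: algebra_simps)
    qed simp
    have fact_w: "p i * w i = 1 / fact (Suc n - i)" if "i < Suc n" for i
      using that by (simp add: p_def w_def Suc_diff_le)
    have S1: "(\<Sum>i<Suc n. A i * p i) = real (Suc n) * A (Suc n)"
      by (simp only: rec lessThan_Suc_atMost p_def) simp
    have S2: "(\<Sum>i<Suc n. b i * p i) = real n * A n"
    proof -
      have "(\<Sum>i<Suc n. b i * p i) = (\<Sum>i<n. A i / fact (n - Suc i))"
        by (simp add: b_def p_def sum.lessThan_Suc_shift del: sum.lessThan_Suc)
      then show ?thesis by (simp only: Suc rec[of m] lessThan_Suc_atMost) simp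
    qed
    have S3: "(\<Sum>i<Suc n. A i * p i * w i) = real (Suc (Suc n)) * A (Suc (Suc n)) - A (Suc n)"
      by (simp only: rec[of "Suc n"]) (simp add: mult.assoc fact_w lessThan_Suc_atMost del: sum.lessThan_Suc)
    have S4: "(\<Sum>i<Suc n. b i * p i * w i) = real (Suc n) * A (Suc n) - A n"
    proof -
      have "(\<Sum>i<Suc n. b i * p i * w i) = (\<Sum>i<Suc n. b i / fact (Suc n - i))"
        by (intro sum.cong refl) (simp add: mult.assoc fact_w)
      also have "\<dots> = (\<Sum>i<n. A i / fact (n - i))"
        by (simp add: sum.lessThan_Suc_shift b_def del: sum.lessThan_Suc)
      finally show ?thesis using rec[of n] by (simp add: lessThan_Suc_atMost[symmetric])
    qed
    have "(\<Sum>i<Suc n. A i * p i * w i) * (\<Sum>i<Suc n. b i * p i)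
        \<le> (\<Sum>i<Suc n. b i * p i * w i) * (\<Sum>i<Suc n. A i * p i)"
    proof (rule chebyshev_double_sum)
      fix i j assume "j \<le> i" "i < Suc n"
      then show "A i * b j \<le> b i * A j"
        using ratio[of "j - 1" "i - 1"] pos[of i] pos[of j] pos[of "i - 1"]
        by (auto simp: b_def split: nat.splits)
    qed (auto simp: p_def w_def frac_le)
    then have "(real (Suc (Suc n)) * A (Suc (Suc n)) - A (Suc n)) * (real n * A n)
       \<le> (real (Suc n) * A (Suc n) - A n) * (real (Suc n) * A (Suc n))"
      by (simp only: S1 S2 S3 S4)
    \<comment> \<open>As \<open>(n + 1)^2 = n * (n + 2) + 1\<close>, exactly one
      \<open>A (Suc n) ^ 2\<close> is left over, and monotonicity pays for it.\<close>
    moreover have "A (Suc n) ^ 2 \<le> A (Suc n) * A n"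
      using dec pos[of "Suc n"] by (simp add: power2_eq_square)
    ultimately have "(real n * real (Suc (Suc n))) * (A n * A (Suc (Suc n)))
        \<le> (real n * real (Suc (Suc n))) * A (Suc n) ^ 2"
      by (simp add: algebra_simps power2_eq_square)
    then show ?thesis using Suc by (simp add: mult_le_cancel_left)
  qed
qed

lemma bell_log_concave: "Suc n * (bell n * bell (Suc (Suc n))) \<le> Suc (Suc n) * bell (Suc n) ^ 2"
proof -
  define A where "A i = real (bell i) / fact i" for i
  have "A n * A (Suc (Suc n)) \<le> A (Suc n) ^ 2"
  proof (rule exp_exp_log_concave)
    fix n
    have "real (bell (Suc n)) / fact n = (\<Sum>k\<le>n. real (n choose k) * bell k / fact n)"
      by (simp only: bell_Suc) (simp add: sum_divide_distrib)
    also have "\<dots> = (\<Sum>k\<le>n. A k / fact (n - k))"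
      by (intro sum.cong refl) (simp add: binomial_fact A_def field_simps)
    finally show "real (Suc n) * A (Suc n) = (\<Sum>i\<le>n. A i / fact (n - i))"
      by (simp add: A_def)
  qed (simp add: A_def bell_pos)
  define K :: real where "K = real (Suc n) ^ 2 * real (Suc (Suc n)) * fact n ^ 2"
  have "real (Suc n * (bell n * bell (Suc (Suc n)))) = K * (A n * A (Suc (Suc n)))"
    by (simp add: K_def A_def divide_simps power2_eq_square) (simp add: algebra_simps)
  also have "\<dots> \<le> K * A (Suc n) ^ 2"
    using \<open>A n * A (Suc (Suc n)) \<le> A (Suc n) ^ 2\<close> by (intro mult_left_mono) (auto simp: K_def)
  also have "\<dots> = real (Suc (Suc n) * bell (Suc n) ^ 2)"
    by (simp add: K_def A_def divide_simps power2_eq_square) (simp add: algebra_simps)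
  finally have "real (Suc n * (bell n * bell (Suc (Suc n)))) \<le> real (Suc (Suc n) * bell (Suc n) ^ 2)" .
  then show ?thesis by (simp only: of_nat_le_iff)
qed

lemma sfree_values: "sfree 1 = 0" "sfree 2 = 1" "sfree 3 = 1" "sfree 4 = 4" "sfree 5 = 11" "sfree 6 = 41"
  "sfree 7 = 162"
proof -
  show 1: "sfree 1 = 0"
    using sfree.simps(2)[of 0] by simp
  show 2: "sfree 2 = 1"
    using sfree.simps(2)[of 1] 1 by (simp add: eval_nat_numeral)
  show 3: "sfree 3 = 1"
    using sfree.simps(2)[of 2] 1 2 by (simp add: eval_nat_numeral)
  show 4: "sfree 4 = 4"
    using sfree.simps(2)[of 3] 1 2 3 by (simp add: eval_nat_numeral)
  show 5: "sfree 5 = 11"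
    using sfree.simps(2)[of 4] 1 2 3 4 by (simp add: eval_nat_numeral)
  show 6: "sfree 6 = 41"
    using sfree.simps(2)[of 5] 1 2 3 4 5 by (simp add: eval_nat_numeral)
  show "sfree 7 = 162"
    using sfree.simps(2)[of 6] 1 2 3 4 5 6 by (simp add: eval_nat_numeral)
qed

lemma bell_values: "bell 1 = 1" "bell 2 = 2" "bell 3 = 5" "bell 4 = 15" "bell 5 = 52" "bell 6 = 203"
  using sfree_values by (simp_all add: bell_def eval_nat_numeral)

text \<open>Log-concavity lets the ratio of consecutive Bell numbers grow by at most the factor
  \<open>(n + 2) / (n + 1)\<close>, and \<open>n * (n + 2) \<le> (n + 1)^2\<close>. The start is
  tight, \<open>bell 4 = 3 * bell 3\<close>; at \<open>n = 2\<close> the bound is false.\<close>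

lemma bell_Suc_le: "n \<ge> 3 \<Longrightarrow> bell (Suc n) \<le> n * bell n"
proof (induction n rule: dec_induct)
  case base
  then show ?case using bell_values by (simp add: eval_nat_numeral)
next
  case (step n)
  have "(Suc n * bell n) * bell (Suc (Suc n)) \<le> Suc (Suc n) * (bell (Suc n) * bell (Suc n))"
    using bell_log_concave[of n] by (simp only: power2_eq_square mult.assoc)
  also have "\<dots> \<le> Suc (Suc n) * ((n * bell n) * bell (Suc n))"
    using step.IH by (intro mult_left_mono mult_right_mono) auto
  also have "\<dots> \<le> (Suc n * bell n) * (Suc n * bell (Suc n))"
    by (simp add: algebra_simps)
  finally show ?case using bell_pos[of n] by (simp only: mult_le_cancel1) auto
qed

text \<open>A lower bound for the share \<open>sfree n / bell n\<close>. The relation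
  \<open>sfree (Suc n) = bell n - sfree n\<close> reverses inequalities, so the induction advances
  by two. At \<open>n = 3\<close> the claim is false, as 25 exceeds 20.\<close>

lemma sfree_ge: "n \<ge> 4 \<Longrightarrow> bell n ^ 2 \<le> sfree n * (bell n + bell (Suc n))"
proof (induction n rule: less_induct)
  case (less n)
  show ?case
  proof (cases "n \<in> {4, 5}")
    case True
    then show ?thesis using bell_values sfree_values by (auto simp: power2_eq_square)
  next
    case False
    define k where "k = n - 2"
    have n: "n = Suc (Suc k)" and k: "k \<ge> 4" using False less.prems by (auto simp: k_def)
    define a b c d x where "a = real (bell k)" and "b = real (bell (Suc k))" and "c = real (bell n)"
      and "d = real (bell (Suc n))" and "x = real (sfree k)"
    note defs = a_def b_def c_def d_def x_def
    have pos: "a > 0" "b > 0" "c > 0" "d > 0" by (simp_all add: defs bell_pos)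
    have IH: "a ^ 2 \<le> x * (a + b)"
      using less.IH[of k] k n of_nat_mono[of "bell k ^ 2" "sfree k * (bell k + bell (Suc k))", where 'a = real]
      by (simp add: defs)
    have y: "real (sfree n) = b - a + x"
      by (simp add: defs n bell_def)
    have conv: "c ^ 2 + b ^ 2 \<le> b * d"
      using of_nat_mono[OF bell_log_convex[of "Suc k"], where 'a = real] by (simp add: defs n)
    have conc: "real (Suc k) * (a * c) \<le> real (Suc (Suc k)) * b ^ 2"
      using of_nat_mono[OF bell_log_concave[of k], where 'a = real] by (simp add: defs n algebra_simps)
    have le: "c \<le> real (Suc k) * b"
      using of_nat_mono[OF bell_Suc_le[of "Suc k"], where 'a = real] k by (simp add: defs n algebra_simps)
    have "real (Suc k) * (a * c ^ 2) \<le> real (Suc (Suc k)) * b ^ 2 * c"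
      using mult_right_mono[OF conc, of c] pos by (simp add: power2_eq_square mult.assoc)
    also have "\<dots> \<le> real (Suc k) * (b ^ 2 * (b + c))"
      using mult_left_mono[OF le, of "b ^ 2"] by (simp add: algebra_simps)
    finally have "a * c ^ 2 \<le> b ^ 2 * (b + c)"
      by (simp add: mult_le_cancel_left)
    \<comment> \<open>The summand \<open>b ^ 2\<close> of the sharpened log-convexity cancels the
      \<open>b ^ 3\<close> on the right of the preceding bound.\<close>
    moreover have "b * (c ^ 2 + b ^ 2) \<le> b * (b * d)"
      using conv pos by (intro mult_left_mono) auto
    ultimately have "c ^ 2 * (a + b) \<le> b ^ 2 * (c + d)"
      by (simp add: algebra_simps power2_eq_square)
    also have "\<dots> \<le> ((b - a + x) * (a + b)) * (c + d)"
      using IH pos by (intro mult_right_mono) (auto simp: algebra_simps power2_eq_square)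
    finally have "c ^ 2 * (a + b) \<le> ((b - a + x) * (c + d)) * (a + b)"
      by (simp add: algebra_simps)
    then have "c ^ 2 \<le> (b - a + x) * (c + d)"
      using pos by (simp add: mult_le_cancel_right)
    then have "real (bell n ^ 2) \<le> real (sfree n * (bell n + bell (Suc n)))"
      by (simp add: y[symmetric]) (simp add: defs)
    then show ?thesis by (simp only: of_nat_le_iff)
  qed
qed

section \<open>Growth, log-convexity and log-concavity of \<open>semifree\<close>\<close>

lemma sfree_mono: "j \<ge> 1 \<Longrightarrow> sfree j \<le> sfree (Suc j)"
proof (cases j)
  case (Suc i)
  have "(\<Sum>k<i. (i choose k) * sfree k) \<le> (\<Sum>k<i. (Suc i choose k) * sfree k)"
    by (intro sum_mono mult_right_mono) (metis Suc_eq_plus1 binomial_right_mono le_add1, simp)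
  then show ?thesis by (simp add: Suc sfree.simps(2))
qed simp

lemma semifree_mono: "j \<ge> 1 \<Longrightarrow> semifree j q \<le> semifree (Suc j) q"
proof (induction q arbitrary: j)
  case (Suc q)
  show ?case using Suc.IH[OF Suc.prems] Suc.IH[of "Suc j"] by simp
qed (simp add: sfree_mono)

lemma semifree_pos: "q \<ge> 1 \<Longrightarrow> semifree j q > 0"
proof (induction q arbitrary: j rule: nat_induct_at_least)
  case base
  then show ?case using semifree_1[of j] bell_pos[of j] by simp
qed simp

text \<open>Adding neighbours keeps a sequence log-convex, because also
  \<open>b * c \<le> a * d\<close>. The induction has to start at the Bell numbers: for
  \<open>q = 0\<close> the claim fails, since \<open>sfree 2 ^ 2 = 1\<close> while
  \<open>sfree 1 * sfree 3 = 0\<close>.\<close>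

lemma semifree_log_convex:
  "q \<ge> 1 \<Longrightarrow> semifree (Suc j) q ^ 2 \<le> semifree j q * semifree (Suc (Suc j)) q"
proof (induction q arbitrary: j rule: nat_induct_at_least)
  case base
  then show ?case using bell_log_convex[of j] by (simp add: semifree_1 del: semifree.simps)
next
  case (Suc q)
  define a b c d where "a = real (semifree j q)" and "b = real (semifree (j + 1) q)"
    and "c = real (semifree (j + 2) q)" and "d = real (semifree (j + 3) q)"
  note defs = a_def b_def c_def d_def
  have pos: "a > 0" "b > 0" "c > 0" "d > 0" using semifree_pos Suc.hyps by (simp_all add: defs)
  have 1: "b ^ 2 \<le> a * c" and 2: "c ^ 2 \<le> b * d"
    using of_nat_mono[OF Suc.IH[of j], where 'a = real] of_nat_mono[OF Suc.IH[of "Suc j"], where 'a = real]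
    by (simp_all add: defs eval_nat_numeral)
  have "b ^ 2 * c ^ 2 \<le> (a * c) * (b * d)" using 1 2 pos by (intro mult_mono) auto
  then have "(b * c) * (b * c) \<le> (a * d) * (b * c)" by (simp add: power2_eq_square algebra_simps)
  then have "b * c \<le> a * d" using pos by (simp add: mult_le_cancel_right)
  then have "(b + c) ^ 2 \<le> (a + b) * (c + d)"
    using 1 2 by (simp add: algebra_simps power2_eq_square)
  then have "real (semifree (Suc j) (Suc q) ^ 2) \<le> real (semifree j (Suc q) * semifree (Suc (Suc j)) (Suc q))"
    by (simp add: defs eval_nat_numeral)
  then show ?case by (simp only: of_nat_le_iff)
qed

text \<open>The factors are those that express log-concavity of \<open>semifree j q / fact j\<close>
  in \<open>j\<close>. In the induction step the bounds for \<open>a * c\<close>,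
  \<open>a * d\<close> and \<open>b * d\<close> add up exactly to the required multiple of
  \<open>(b + c) ^ 2\<close>.\<close>

lemma semifree_log_concave:
  "q \<ge> 1 \<Longrightarrow> Suc j * (semifree j q * semifree (Suc (Suc j)) q) \<le> Suc (Suc j) * semifree (Suc j) q ^ 2"
proof (induction q arbitrary: j rule: nat_induct_at_least)
  case base
  then show ?case using bell_log_concave[of j] by (simp only: semifree_1 One_nat_def)
next
  case (Suc q)
  define N a b c d where "N = real (Suc j)" and "a = real (semifree j q)" and "b = real (semifree (j + 1) q)"
    and "c = real (semifree (j + 2) q)" and "d = real (semifree (j + 3) q)"
  note defs = a_def b_def c_def d_def
  have pos: "a > 0" "b > 0" "c > 0" "d > 0" and N: "N > 0"
    using semifree_pos Suc.hyps by (simp_all add: defs N_def)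
  have 1: "N * (a * c) \<le> (N + 1) * b ^ 2"
    using of_nat_mono[OF Suc.IH[of j], where 'a = real] by (simp add: defs N_def eval_nat_numeral algebra_simps)
  have 2: "(N + 1) * (b * d) \<le> (N + 2) * c ^ 2"
    using of_nat_mono[OF Suc.IH[of "Suc j"], where 'a = real]
    by (simp add: defs N_def eval_nat_numeral algebra_simps)
  have "(N * (a * c)) * ((N + 1) * (b * d)) \<le> ((N + 1) * b ^ 2) * ((N + 2) * c ^ 2)"
    by (rule mult_mono[OF 1 2]) (use pos N in auto)
  then have "(N * (a * d)) * ((N + 1) * (b * c)) \<le> ((N + 2) * (b * c)) * ((N + 1) * (b * c))"
    by (simp add: power2_eq_square algebra_simps)
  then have 3: "N * (a * d) \<le> (N + 2) * (b * c)" using pos N by (simp add: mult_le_cancel_right)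
  have "N * ((N + 1) * (b * d)) \<le> N * ((N + 2) * c ^ 2)" using 2 N by (intro mult_left_mono) auto
  also have "\<dots> \<le> (N + 1) * ((N + 1) * c ^ 2)"
    by (simp add: algebra_simps)
  finally have "(N + 1) * (N * (b * d)) \<le> (N + 1) * ((N + 1) * c ^ 2)" by (simp add: algebra_simps)
  then have 4: "N * (b * d) \<le> (N + 1) * c ^ 2" using N by (simp add: mult_le_cancel_left)
  have "N * ((a + b) * (c + d)) \<le> (N + 1) * (b + c) ^ 2"
    using 1 3 4 by (simp add: algebra_simps power2_eq_square)
  then have "real (Suc j * (semifree j (Suc q) * semifree (Suc (Suc j)) (Suc q)))
      \<le> real (Suc (Suc j) * semifree (Suc j) (Suc q) ^ 2)"
    by (simp add: defs N_def eval_nat_numeral algebra_simps)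
  then show ?case by (simp only: of_nat_le_iff)
qed

lemma semifree_fibonacci:
  "q \<ge> 1 \<Longrightarrow> semifree j q + semifree (Suc j) q \<le> semifree (Suc (Suc j)) q"
proof (induction q arbitrary: j rule: nat_induct_at_least)
  case base
  have "bell j \<le> Suc j * bell j" by simp
  then show ?case using bell_ge[of "Suc j"] by (simp only: semifree_1 One_nat_def) simp
next
  case (Suc q)
  show ?case using Suc.IH[of j] Suc.IH[of "Suc j"] by simp
qed

text \<open>Equivalent to \<open>frankl_weight t r q \<le> frankl_weight t (r - 1) (q + 2)\<close> below (for \<open>r \<ge> 1\<close>): passing from the
  \<open>(r - 1)\<close>-st to the \<open>r\<close>-th extremal family does not pay.\<close>

definition level_drop :: "nat \<Rightarrow> nat \<Rightarrow> nat \<Rightarrow> bool" where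
  "level_drop t r q \<longleftrightarrow> (t + 2 * r - 1) * semifree r q \<le> r * semifree r (Suc q)"

section \<open>Propagation of a drop to the next candidate\<close>

lemma level_drop_iff:
  assumes "t \<ge> 1"
  shows "level_drop t r q \<longleftrightarrow>
    (real t - 1) * semifree r q \<le> real r * (real (semifree (Suc r) q) - real (semifree r q))"
proof -
  have "level_drop t r q \<longleftrightarrow> real ((t + 2 * r - 1) * semifree r q) \<le> real (r * semifree r (Suc q))"
    unfolding level_drop_def of_nat_le_iff ..
  also have "real ((t + 2 * r - 1) * semifree r q) = (real t + 2 * real r - 1) * semifree r q"
    using assms by (simp add: of_nat_diff)
  finally show ?thesis by (simp add: algebra_simps)
qed

text \<open>\<open>level_drop_iff\<close> isolates \<open>t\<close>: a drop bounds
  \<open>t - 1\<close> by \<open>r\<close> times a ratio minus one, and that bound does not involve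
  \<open>t\<close>. With \<open>t + 2 * r + q\<close> fixed, the bounds at \<open>(r, q + 2)\<close>
  and \<open>(r + 1, q)\<close> have to be compared; the third assumption does so with cleared
  denominators, since \<open>semifree (Suc r) q\<close> may vanish.\<close>

lemma level_drop_Suc_aux:
  assumes "t \<ge> 1" "level_drop t r (Suc (Suc q))"
    and "real r * (real (semifree (Suc r) (Suc (Suc q))) - real (semifree r (Suc (Suc q)))) * semifree (Suc r) q
      \<le> real (Suc r) * (real (semifree (Suc (Suc r)) q) - real (semifree (Suc r) q)) * semifree r (Suc (Suc q))"
  shows "level_drop t (Suc r) q"
proof -
  define D where "D = real (semifree r (Suc (Suc q)))"
  have "D > 0" unfolding D_def using semifree_pos[of "Suc (Suc q)" r] by (simp del: semifree.simps)
  have "((real t - 1) * semifree (Suc r) q) * D = ((real t - 1) * D) * semifree (Suc r) q"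
    by simp
  also have "\<dots> \<le> (real r * (real (semifree (Suc r) (Suc (Suc q))) - D)) * semifree (Suc r) q"
    using assms(2) unfolding level_drop_iff[OF assms(1)] D_def by (rule mult_right_mono) simp
  also have "\<dots> \<le> (real (Suc r) * (real (semifree (Suc (Suc r)) q) - real (semifree (Suc r) q))) * D"
    using assms(3) by (simp only: D_def)
  finally show ?thesis
    using \<open>D > 0\<close> unfolding level_drop_iff[OF assms(1)] by (simp only: mult_le_cancel_right)
qed

lemma level_drop_Suc_pos:
  assumes "t \<ge> 1" "q \<ge> 1" "level_drop t r (Suc (Suc q))"
  shows "level_drop t (Suc r) q"
proof (rule level_drop_Suc_aux[OF assms(1,3)])
  define R a b c d where "R = real r" and "a = real (semifree r q)" and "b = real (semifree (Suc r) q)"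
    and "c = real (semifree (Suc (Suc r)) q)" and "d = real (semifree (Suc (Suc (Suc r))) q)"
  note defs = R_def a_def b_def c_def d_def
  have pos: "a > 0" "b > 0" "c > 0" "d > 0" and R: "R \<ge> 0"
    using semifree_pos assms(2) by (simp_all add: defs)
  have convex: "b ^ 2 \<le> a * c"
    using of_nat_mono[OF semifree_log_convex[OF assms(2), of r], where 'a = real] by (simp add: defs)
  have concave: "(R + 2) * (b * d) \<le> (R + 3) * c ^ 2"
    using of_nat_mono[OF semifree_log_concave[OF assms(2), of "Suc r"], where 'a = real]
    by (simp add: defs algebra_simps)
  have fib: "a + b \<le> c"
    using of_nat_mono[OF semifree_fibonacci[OF assms(2), of r], where 'a = real] by (simp add: defs)
  have "(R + 2) * (R * (b * d)) \<le> R * ((R + 3) * c ^ 2)"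
    using mult_left_mono[OF concave R] by (simp add: algebra_simps)
  also have "\<dots> \<le> (R + 2) * ((R + 1) * c ^ 2)"
    by (simp add: algebra_simps)
  finally have 1: "R * (b * d) \<le> (R + 1) * c ^ 2"
    using R by (simp add: mult_le_cancel_left)
  have 2: "(R + 1) * b ^ 2 \<le> (R + 1) * (a * c)"
    using convex R by (intro mult_left_mono) auto
  have 3: "b * (a + b) \<le> b * c"
    using fib pos by (intro mult_left_mono) auto
  \<comment> \<open>Two steps of the recursion give \<open>a + 2 * b + c\<close> and
    \<open>b + 2 * c + d\<close> for the values at \<open>q + 2\<close>. Right side minus left side
    is the sum of the slacks in \<open>1\<close>, \<open>2\<close> and \<open>3\<close>.\<close>
  have "R * ((b + 2 * c + d) - (a + 2 * b + c)) * b \<le> (R + 1) * (c - b) * (a + 2 * b + c)"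
    using 1 2 3 by (simp add: algebra_simps power2_eq_square)
  then show "real r * (real (semifree (Suc r) (Suc (Suc q))) - real (semifree r (Suc (Suc q)))) * semifree (Suc r) q
      \<le> real (Suc r) * (real (semifree (Suc (Suc r)) q) - real (semifree (Suc r) q)) * semifree r (Suc (Suc q))"
    by (simp add: defs algebra_simps)
qed

text \<open>\<open>sfree_ge\<close> replaces the failing log-convexity from \<open>r = 4\<close> on;
  smaller cases are evaluated. The exclusion is genuine: for \<open>t = 2\<close>,
  \<open>level_drop\<close> holds at \<open>r = 1\<close>, \<open>q = 2\<close> by
  \<open>9 \<le> 10\<close> and would at \<open>r = 2\<close>, \<open>q = 0\<close> require
  \<open>5 \<le> 4\<close>.\<close>

lemma level_drop_Suc_0:
  assumes "t \<ge> 1" "r \<ge> 1" "r = 1 \<Longrightarrow> t \<noteq> 2" "level_drop t r 2"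
  shows "level_drop t (Suc r) 0"
proof -
  have D: "sfree (Suc 0) = 0" "sfree (Suc (Suc 0)) = 1" "sfree (Suc (Suc (Suc 0))) = 1"
    "sfree (Suc (Suc (Suc (Suc 0)))) = 4" "sfree (Suc (Suc (Suc (Suc (Suc 0))))) = 11"
    "sfree (Suc (Suc (Suc (Suc (Suc (Suc 0)))))) = 41"
    using sfree_values by (simp_all add: numeral_eq_Suc)
  consider "r = 1" | "r = 2" | "r = 3" | "r \<ge> 4" using assms(2) by linarith
  then show ?thesis
  proof cases
    case 1
    then show ?thesis using assms by (simp add: level_drop_def D numeral_2_eq_2 numeral_3_eq_3)
  next
    case 2
    then show ?thesis using assms by (simp add: level_drop_def D numeral_2_eq_2 numeral_3_eq_3)
  next
    case 3
    then show ?thesis using assms by (simp add: level_drop_def D numeral_2_eq_2 numeral_3_eq_3)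
  next
    case 4
    show ?thesis
    proof (rule level_drop_Suc_aux[OF assms(1)])
      show "level_drop t r (Suc (Suc 0))" using assms(4) by (simp add: numeral_2_eq_2)
      define R a b c x where "R = real r" and "a = real (bell r)" and "b = real (bell (Suc r))"
        and "c = real (bell (Suc (Suc r)))" and "x = real (sfree (Suc r))"
      note defs = R_def a_def b_def c_def x_def
      have pos: "a > 0" "b > 0" "c > 0" and R: "R \<ge> 0" and x: "x \<ge> 0" by (simp_all add: defs bell_pos)
      have concave: "(R + 1) * (a * c) \<le> (R + 2) * b ^ 2"
        using of_nat_mono[OF bell_log_concave[of r], where 'a = real] by (simp add: defs algebra_simps)
      have sq: "(R + 1) * a ^ 2 \<le> b ^ 2"
        using of_nat_mono[OF Suc_bell_square_le[of r], where 'a = real] by (simp add: defs algebra_simps)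
      \<comment> \<open>As \<open>x = a - sfree r\<close>, the lower bound for
        \<open>sfree r\<close> bounds \<open>x\<close> from above. With \<open>x\<close> collected,
        the goal bounds \<open>x\<close> times a bracket; \<open>ub\<close> estimates
        \<open>x\<close> and \<open>br\<close> the bracket.\<close>
      have "a ^ 2 \<le> (a - x) * (a + b)"
        using of_nat_mono[OF sfree_ge[OF 4], where 'a = real] by (simp add: defs bell_def)
      then have ub: "x * (a + b) \<le> a * b"
        by (simp add: algebra_simps power2_eq_square)
      have "(R + 1) * (a * (R * c + 2 * (R + 1) * b + (R + 2) * a))
          \<le> R * ((R + 2) * b ^ 2) + (R + 1) * (2 * (R + 1) * (a * b) + (R + 2) * a ^ 2)"
        using mult_left_mono[OF concave R] by (simp add: algebra_simps power2_eq_square)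
      also have "\<dots> \<le> (R + 1) * ((R + 1) * (a + b) ^ 2)"
        using sq by (simp add: algebra_simps power2_eq_square)
      finally have br: "a * (R * c + 2 * (R + 1) * b + (R + 2) * a) \<le> (R + 1) * (a + b) ^ 2"
        using R by (simp add: mult_le_cancel_left)
      have "(x * (R * c + 2 * (R + 1) * b + (R + 2) * a)) * (a * (a + b))
          = (x * (a + b)) * (a * (R * c + 2 * (R + 1) * b + (R + 2) * a))"
        by (simp add: algebra_simps)
      also have "\<dots> \<le> (a * b) * ((R + 1) * (a + b) ^ 2)"
        by (rule mult_mono[OF ub br]) (use pos R in auto)
      also have "\<dots> = ((R + 1) * b * (a + b)) * (a * (a + b))"
        by (simp add: algebra_simps power2_eq_square)
      finally have "x * (R * c + 2 * (R + 1) * b + (R + 2) * a) \<le> (R + 1) * b * (a + b)"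
        using pos by (simp add: mult_le_cancel_right)
      then have "R * ((b + c) - (a + b)) * x \<le> (R + 1) * ((b - x) - x) * (a + b)"
        by (simp add: algebra_simps)
      moreover have "real (sfree (Suc (Suc r))) = b - x" by (simp add: defs bell_def)
      moreover have "real (semifree r (Suc (Suc 0))) = a + b" "real (semifree (Suc r) (Suc (Suc 0))) = b + c"
        by (simp_all add: defs bell_def)
      ultimately show "real r * (real (semifree (Suc r) (Suc (Suc 0))) - real (semifree r (Suc (Suc 0)))) * semifree (Suc r) 0
        \<le> real (Suc r) * (real (semifree (Suc (Suc r)) 0) - real (semifree (Suc r) 0)) * semifree r (Suc (Suc 0))"
        by (simp only: semifree.simps(1) x_def[symmetric] R_def of_nat_Suc) (simp add: algebra_simps)
    qed
  qed
qed

subsection \<open>Shifting weighted intersecting families\<close>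

definition set_t_intersecting :: "nat \<Rightarrow> 'a set set \<Rightarrow> bool" where
  "set_t_intersecting t H \<longleftrightarrow> (\<forall>S\<in>H. \<forall>T\<in>H. t \<le> card (S \<inter> T))"

text \<open>For \<open>H\<close> on the first \<open>m\<close> points, the number of partitions of
  \<open>m + q\<close> points whose fixed points among the first \<open>m\<close> form a member of
  \<open>H\<close>: the remaining \<open>m - card S\<close> of these must not be singletons, the
  last \<open>q\<close> are free.\<close>

definition family_weight :: "nat \<Rightarrow> nat \<Rightarrow> nat set set \<Rightarrow> nat" where
  "family_weight m q H = (\<Sum>S\<in>H. semifree (m - card S) q)"

definition replace :: "'a \<Rightarrow> 'a \<Rightarrow> 'a set \<Rightarrow> 'a set" where
  "replace i j S = insert i (S - {j})"

definition shift :: "'a \<Rightarrow> 'a \<Rightarrow> 'a set set \<Rightarrow> 'a set \<Rightarrow> 'a set" where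
  "shift i j H S = (if j \<in> S \<and> i \<notin> S \<and> replace i j S \<notin> H then replace i j S else S)"

lemma card_replace: "finite S \<Longrightarrow> j \<in> S \<Longrightarrow> i \<notin> S \<Longrightarrow> card (replace i j S) = card S"
  by (metis card_insert_disjoint card_Suc_Diff1 finite_Diff replace_def Diff_iff)

lemma inj_on_shift: "inj_on (shift i j H) H"
proof (rule inj_onI)
  have cancel: "S = T" if "j \<in> S" "i \<notin> S" "j \<in> T" "i \<notin> T" "replace i j S = replace i j T" for S T
    using that unfolding replace_def by (metis Diff_insert_absorb insert_Diff insert_iff)
  fix S T assume "S \<in> H" "T \<in> H" "shift i j H S = shift i j H T"
  then show "S = T" using cancel[of S T] unfolding shift_def by (auto split: if_splits)
qed

text \<open>The mixed case. If \<open>T\<close> contains \<open>j\<close> and not \<open>i\<close>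
  but stays, then \<open>replace i j T\<close> is already in \<open>H\<close>, and it meets
  \<open>S\<close> in the same points in which \<open>T\<close> meets the shifted
  \<open>S\<close>.\<close>

lemma shift_pair:
  assumes "i \<noteq> j" "S \<in> H" "T \<in> H" "finite S" "finite T" and "shift i j H S \<noteq> S" and "shift i j H T = T"
    and int: "set_t_intersecting t H"
  shows "t \<le> card (shift i j H S \<inter> T)"
proof -
  have S: "j \<in> S" "i \<notin> S" and eq: "shift i j H S = replace i j S"
    using assms(6) unfolding shift_def by (auto split: if_splits)
  consider "j \<in> T" "i \<notin> T" | "i \<in> T" "j \<in> T" | "j \<notin> T" by blast
  then show ?thesis
  proof cases
    case 1
    then have "replace i j T \<in> H"
      using assms(7) unfolding shift_def replace_def by (auto split: if_splits)
    then have "t \<le> card (S \<inter> replace i j T)"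
      using int assms(2) unfolding set_t_intersecting_def by blast
    also have "S \<inter> replace i j T = replace i j S \<inter> T"
      using S 1 unfolding replace_def by auto
    finally show ?thesis by (simp add: eq)
  next
    case 2
    then have "replace i j S \<inter> T = replace i j (S \<inter> T)"
      unfolding replace_def by auto
    then have "card (replace i j S \<inter> T) = card (S \<inter> T)"
      using card_replace[of "S \<inter> T" j i] S 2 assms(4) by auto
    then show ?thesis using int assms(2,3) unfolding set_t_intersecting_def eq by auto
  next
    case 3
    then have "S \<inter> T \<subseteq> replace i j S \<inter> T" unfolding replace_def by auto
    then have "card (S \<inter> T) \<le> card (replace i j S \<inter> T)"
      using assms(5) by (intro card_mono) auto
    then show ?thesis using int assms(2,3) unfolding set_t_intersecting_def eq by (meson le_trans)
  qed
qed

lemma shift_t_intersecting: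
  assumes "i \<noteq> j" "set_t_intersecting t H" and fin: "\<And>S. S \<in> H \<Longrightarrow> finite S"
  shows "set_t_intersecting t (shift i j H ` H)"
proof -
  have "t \<le> card (shift i j H S \<inter> shift i j H T)" if ST: "S \<in> H" "T \<in> H" for S T
  proof -
    have le: "t \<le> card (S \<inter> T)" using assms(2) ST unfolding set_t_intersecting_def by blast
    consider "shift i j H S = S" "shift i j H T = T" | "shift i j H S \<noteq> S" "shift i j H T = T"
      | "shift i j H S = S" "shift i j H T \<noteq> T" | "shift i j H S \<noteq> S" "shift i j H T \<noteq> T" by blast
    then show ?thesis
    proof cases
      case 1
      with le show ?thesis by simp
    next
      case 2
      then show ?thesis using shift_pair[OF assms(1) ST fin fin, of t] ST assms(2) by simp
    next
      case 3
      then show ?thesis using shift_pair[OF assms(1) ST(2,1) fin fin, of t] ST assms(2)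
        by (simp add: Int_commute)
    next
      case 4
      then have "j \<in> S" "i \<notin> S" "j \<in> T" "i \<notin> T" and eq: "shift i j H S = replace i j S" "shift i j H T = replace i j T"
        unfolding shift_def by (auto split: if_splits)
      then have "replace i j S \<inter> replace i j T = replace i j (S \<inter> T)"
        unfolding replace_def by auto
      then show ?thesis using le eq card_replace[of "S \<inter> T" j i] \<open>j \<in> S\<close> \<open>i \<notin> S\<close> \<open>j \<in> T\<close> fin[OF ST(1)]
        by simp
    qed
  qed
  then show ?thesis unfolding set_t_intersecting_def by blast
qed

definition upset_on :: "'a set \<Rightarrow> 'a set set \<Rightarrow> bool" where
  "upset_on A H \<longleftrightarrow> (\<forall>S\<in>H. \<forall>T. S \<subseteq> T \<longrightarrow> T \<subseteq> A \<longrightarrow> T \<in> H)"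

definition left_shifted :: "nat set set \<Rightarrow> bool" where
  "left_shifted H \<longleftrightarrow> (\<forall>S\<in>H. \<forall>i j. 1 \<le> i \<longrightarrow> i < j \<longrightarrow> j \<in> S \<longrightarrow> i \<notin> S \<longrightarrow> replace i j S \<in> H)"

lemma exists_left_shifted_upset:
  assumes "H0 \<subseteq> Pow {1..m}" "set_t_intersecting t H0"
  obtains H where "H \<subseteq> Pow {1..m}" "set_t_intersecting t H" "upset_on {1..m} H" "left_shifted H"
    "family_weight m q H0 \<le> family_weight m q H"
proof -
  define X where "X = {H. H \<subseteq> Pow {1..m} \<and> set_t_intersecting t H \<and> family_weight m q H0 \<le> family_weight m q H}"
  \<comment> \<open>The \<open>Suc\<close> makes every additional set count, which forces a
    maximiser to be an upset; the inner sum grows when an element moves left, which forces it to be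
    left-shifted.\<close>
  define pot :: "nat set set \<Rightarrow> nat" where "pot H = (\<Sum>S\<in>H. Suc (\<Sum>i\<in>S. m - i))" for H
  have "finite X" by (rule finite_subset[of _ "Pow (Pow {1..m})"]) (auto simp: X_def)
  moreover have "H0 \<in> X" using assms by (simp add: X_def)
  ultimately have "Max (pot ` X) \<in> pot ` X" by (intro Max_in) auto
  then obtain H where H: "H \<in> X" and "pot H = Max (pot ` X)" by auto
  then have max: "pot H' \<le> pot H" if "H' \<in> X" for H'
    using that \<open>finite X\<close> by (auto intro: Max_ge)
  have sub: "H \<subseteq> Pow {1..m}" and int: "set_t_intersecting t H" and w: "family_weight m q H0 \<le> family_weight m q H"
    using H by (auto simp: X_def)
  have finH: "finite H" using sub finite_subset by blast
  have fin: "finite S" if "S \<in> H" for S using sub that finite_subset by blast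
  have "upset_on {1..m} H"
    unfolding upset_on_def
  proof (intro ballI allI impI)
    fix S T assume ST: "S \<in> H" "S \<subseteq> T" "T \<subseteq> {1..m}"
    then have finT: "finite T" using finite_subset by blast
    have le: "t \<le> card (T \<inter> U)" if "U \<in> H" for U
    proof -
      have "t \<le> card (S \<inter> U)" using int ST that unfolding set_t_intersecting_def by blast
      also have "\<dots> \<le> card (T \<inter> U)" using ST finT by (intro card_mono) auto
      finally show ?thesis .
    qed
    have "t \<le> card (T \<inter> T)"
      using le[OF ST(1)] card_mono[of T "T \<inter> S"] finT by simp
    with le int have "set_t_intersecting t (insert T H)"
      unfolding set_t_intersecting_def by (auto simp: Int_commute)
    moreover have "T \<notin> H \<Longrightarrow> family_weight m q H \<le> family_weight m q (insert T H)"
      using finH by (simp add: family_weight_def)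
    ultimately have "T \<notin> H \<Longrightarrow> insert T H \<in> X"
      using sub ST w by (auto simp: X_def)
    moreover have "T \<notin> H \<Longrightarrow> pot H < pot (insert T H)"
      using finH by (simp add: pot_def)
    ultimately show "T \<in> H" using max by (meson linorder_not_less)
  qed
  moreover have "left_shifted H"
    unfolding left_shifted_def
  proof (intro ballI allI impI, rule ccontr)
    fix S i j assume S: "S \<in> H" and ij: "1 \<le> i" "i < j" "j \<in> S" "i \<notin> S" and notin: "replace i j S \<notin> H"
    let ?C = "shift i j H ` H"
    have ground: "T \<subseteq> {1..m}" if "T \<in> H" for T using sub that by blast
    have jm: "j \<le> m" using ground[OF S] ij(3) by (metis atLeastAtMost_iff subsetD)
    have "shift i j H T \<subseteq> {1..m}" if "T \<in> H" for T
    proof -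
      have "shift i j H T \<subseteq> insert i T" by (auto simp: shift_def replace_def)
      also have "\<dots> \<subseteq> {1..m}" using ground[OF that] ij jm by auto
      finally show ?thesis .
    qed
    then have "?C \<subseteq> Pow {1..m}" by blast
    moreover have "set_t_intersecting t ?C"
      using shift_t_intersecting[of i j t H, OF _ int fin] ij(2) by simp
    moreover have "family_weight m q ?C = family_weight m q H"
    proof -
      have "card (shift i j H T) = card T" if "T \<in> H" for T
        using card_replace[OF fin[OF that], of j i] by (simp add: shift_def)
      then show ?thesis by (simp add: family_weight_def sum.reindex[OF inj_on_shift])
    qed
    ultimately have "?C \<in> X" using w by (simp add: X_def)
    have less: "(\<Sum>x\<in>T. m - x) < (\<Sum>x\<in>replace i j T. m - x)" if "T \<in> H" "j \<in> T" "i \<notin> T" for T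
    proof -
      have "(\<Sum>x\<in>T. m - x) = (m - j) + (\<Sum>x\<in>T - {j}. m - x)"
        using fin that by (simp add: sum.remove)
      also have "\<dots> < (m - i) + (\<Sum>x\<in>T - {j}. m - x)"
        using ij jm by simp
      also have "\<dots> = (\<Sum>x\<in>replace i j T. m - x)"
        using fin that by (simp add: replace_def)
      finally show ?thesis .
    qed
    have "pot H < (\<Sum>T\<in>H. Suc (\<Sum>x\<in>shift i j H T. m - x))"
      unfolding pot_def
    proof (rule sum_strict_mono_ex1[OF finH])
      show "\<forall>T\<in>H. Suc (\<Sum>x\<in>T. m - x) \<le> Suc (\<Sum>x\<in>shift i j H T. m - x)"
        using less by (auto simp: shift_def intro: less_imp_le)
      show "\<exists>T\<in>H. Suc (\<Sum>x\<in>T. m - x) < Suc (\<Sum>x\<in>shift i j H T. m - x)"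
        using S ij notin less by (intro bexI[of _ S]) (auto simp: shift_def)
    qed
    also have "\<dots> = pot ?C"
      unfolding pot_def sum.reindex[OF inj_on_shift] by simp
    finally show False using max[OF \<open>?C \<in> X\<close>] by simp
  qed
  ultimately show thesis using that sub int w by blast
qed

section \<open>Choosing the sizes and the sets to keep\<close>

text \<open>Of two levels \<open>a\<close> and \<open>N - a\<close> one has to go: dropping
  \<open>a\<close> costs \<open>f a\<close>, while keeping it gains \<open>h a\<close> on top of
  \<open>f a\<close>. Levels above \<open>N\<close> have no partner and are all kept; the
  self-paired level is left aside.\<close>

lemma select_indices:
  fixes f h :: "nat \<Rightarrow> nat"
  assumes "N \<le> k" and alt: "\<And>a. a \<le> N \<Longrightarrow> 2 * a \<noteq> N \<Longrightarrow> f (N - a) \<le> h a \<or> f a \<le> h (N - a)"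
  obtains I where "\<And>a b. a \<in> I \<Longrightarrow> b \<in> I \<Longrightarrow> a + b \<noteq> N"
    and "(\<Sum>a | a \<le> k \<and> 2 * a \<noteq> N. f a) \<le> (\<Sum>a | a \<le> k \<and> a \<in> I. f a + h a)"
proof
  \<comment> \<open>If both alternatives hold for a pair, the smaller index is kept.\<close>
  define I where "I = {a. N < a} \<union> {a. a \<le> N \<and> 2 * a \<noteq> N \<and> f (N - a) \<le> h a \<and> (a < N - a \<or> \<not> f a \<le> h (N - a))}"
  define J where "J = {a. a \<le> N \<and> 2 * a \<noteq> N \<and> a \<notin> I}"
  show "a + b \<noteq> N" if "a \<in> I" "b \<in> I" for a b
  proof
    assume "a + b = N"
    then have b: "b = N - a" and "a \<le> N" by auto
    show False using that \<open>a \<le> N\<close> unfolding b by (auto simp: I_def)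
  qed
  have J: "N - a \<in> I \<and> f a \<le> h (N - a)" if "a \<in> J" for a
  proof -
    have "a \<le> N" "2 * a \<noteq> N" "a \<notin> I" using that by (auto simp: J_def)
    moreover have "2 * (N - a) \<noteq> N" "N - (N - a) = a" using calculation by auto
    ultimately show ?thesis using alt[of a] unfolding I_def by force
  qed
  have "{a. a \<le> k \<and> 2 * a \<noteq> N} = {a. a \<le> k \<and> a \<in> I} \<union> J"
    using assms(1) by (auto simp: I_def J_def)
  moreover have "{a. a \<le> k \<and> a \<in> I} \<inter> J = {}" by (auto simp: J_def)
  moreover have fin: "finite {a. a \<le> k \<and> a \<in> I}" "finite J"
    by (auto simp: J_def)
  ultimately have "(\<Sum>a | a \<le> k \<and> 2 * a \<noteq> N. f a) = (\<Sum>a | a \<le> k \<and> a \<in> I. f a) + (\<Sum>a\<in>J. f a)"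
    by (simp add: sum.union_disjoint)
  also have "(\<Sum>a\<in>J. f a) \<le> (\<Sum>a\<in>J. h (N - a))" using J by (intro sum_mono) auto
  also have "\<dots> = (\<Sum>b\<in>(\<lambda>a. N - a) ` J. h b)"
    by (subst sum.reindex) (auto simp: inj_on_def J_def)
  also have "\<dots> \<le> (\<Sum>a | a \<le> k \<and> a \<in> I. h a)"
    using J fin assms(1) by (intro sum_mono2) auto
  finally show "(\<Sum>a | a \<le> k \<and> 2 * a \<noteq> N. f a) \<le> (\<Sum>a | a \<le> k \<and> a \<in> I. f a + h a)"
    by (simp add: sum.distrib)
qed

text \<open>Double counting of the pairs of a set and a point that it misses; some point reaches the
  average.\<close>

lemma exists_often_missed:
  assumes "finite A" "A \<noteq> {}" "finite G" "\<And>S. S \<in> G \<Longrightarrow> S \<subseteq> A \<and> card A - card S = r"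
  shows "\<exists>i\<in>A. r * card G \<le> card A * card {S\<in>G. i \<notin> S}"
proof -
  have "(\<Sum>i\<in>A. card {S\<in>G. i \<notin> S}) = (\<Sum>S\<in>G. card {i\<in>A. i \<notin> S})"
    by (rule sum_multicount_gen) (use assms in auto)
  also have "\<dots> = (\<Sum>S\<in>G. r)"
  proof (intro sum.cong refl)
    fix S assume "S \<in> G"
    moreover have "{i\<in>A. i \<notin> S} = A - S" by auto
    ultimately show "card {i\<in>A. i \<notin> S} = r"
      using assms(1,4) by (metis card_Diff_subset finite_subset)
  qed
  finally have eq: "(\<Sum>i\<in>A. card {S\<in>G. i \<notin> S}) = r * card G" by simp
  show ?thesis
  proof (rule ccontr)
    assume "\<not> ?thesis"
    then have "(\<Sum>i\<in>A. card A * card {S\<in>G. i \<notin> S}) < (\<Sum>i\<in>A. r * card G)"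
      using assms(1,2) by (intro sum_strict_mono) (auto simp: not_le)
    then show False by (simp add: sum_distrib_left[symmetric] eq)
  qed
qed

text \<open>A coordinate on which membership does not depend may be treated as a free point; its two
  states are the two terms of the recursion of \<open>semifree\<close>.\<close>

lemma family_weight_Suc:
  assumes "K \<subseteq> Pow {1..m}"
  shows "family_weight (Suc m) q (K \<union> insert (Suc m) ` K) = family_weight m (Suc q) K"
proof -
  have finK: "finite K" using assms finite_subset by blast
  have not_in: "Suc m \<notin> S" "finite S" "card S \<le> m" if "S \<in> K" for S
  proof -
    have S: "S \<subseteq> {1..m}" using that assms by blast
    show "Suc m \<notin> S" "finite S" using S finite_subset by auto
    show "card S \<le> m" using card_mono[OF _ S] by simp
  qed
  have "inj_on (insert (Suc m)) K"
    using not_in by (intro inj_onI) (metis insert_ident)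
  moreover have "K \<inter> insert (Suc m) ` K = {}" using not_in by blast
  ultimately have "family_weight (Suc m) q (K \<union> insert (Suc m) ` K)
      = (\<Sum>S\<in>K. semifree (Suc m - card S) q) + (\<Sum>S\<in>K. semifree (Suc m - card (insert (Suc m) S)) q)"
    unfolding family_weight_def using finK by (simp add: sum.union_disjoint sum.reindex)
  also have "(\<Sum>S\<in>K. semifree (Suc m - card S) q) = (\<Sum>S\<in>K. semifree (Suc (m - card S)) q)"
    using not_in by (intro sum.cong refl) (simp add: Suc_diff_le)
  also have "(\<Sum>S\<in>K. semifree (Suc m - card (insert (Suc m) S)) q) = (\<Sum>S\<in>K. semifree (m - card S) q)"
    using not_in by (intro sum.cong refl) simp
  finally show ?thesis by (simp add: family_weight_def sum.distrib)
qed

subsection \<open>Removing the last coordinate\<close>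

locale shifted_family =
  fixes t k q :: nat and H :: "nat set set"
  assumes t_pos: "1 \<le> t" and t_le: "t \<le> k" and ground: "H \<subseteq> Pow {1..Suc k}"
    and int: "set_t_intersecting t H" and upset: "upset_on {1..Suc k} H" and shifted: "left_shifted H"
begin

text \<open>In an upset these are the sets that stay in the family with and without the last
  coordinate, so their weight survives its deletion.\<close>

definition base :: "nat set set" where
  "base = {S\<in>H. Suc k \<notin> S}"

definition boundary :: "nat set set" where
  "boundary = {S. S \<subseteq> {1..k} \<and> S \<notin> H \<and> insert (Suc k) S \<in> H}"

text \<open>The number of points that two conflicting boundary sets miss altogether, by
  \<open>conflict\<close>.\<close>

definition N :: nat where
  "N = Suc k - t"

definition level :: "nat \<Rightarrow> nat set set" where
  "level a = {S\<in>boundary. k - card S = a}"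

lemma base_subset: "S \<in> base \<Longrightarrow> S \<subseteq> {1..k}"
  using ground by (auto simp: base_def atLeastAtMostSuc_conv)

lemma boundary_subset: "S \<in> boundary \<Longrightarrow> S \<subseteq> {1..k}"
  by (simp add: boundary_def)

lemma finite_base [simp]: "finite base"
  using base_subset by (rule_tac finite_subset[of _ "Pow {1..k}"]) auto

lemma finite_boundary [simp]: "finite boundary"
  using boundary_subset by (rule_tac finite_subset[of _ "Pow {1..k}"]) auto

lemma finite_level [simp]: "finite (level a)"
  by (simp add: level_def)

lemma base_boundary_disjoint: "base \<inter> boundary = {}"
  by (auto simp: base_def boundary_def)

lemma boundary_card_le: "S \<in> boundary \<Longrightarrow> card S \<le> k"
  using card_mono[OF _ boundary_subset] by fastforce

lemma insert_base: "S \<in> base \<Longrightarrow> insert (Suc k) S \<in> H"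
proof -
  assume S: "S \<in> base"
  then have "insert (Suc k) S \<subseteq> {1..Suc k}" using base_subset[OF S] by auto
  moreover have "S \<in> H" using S by (simp add: base_def)
  ultimately show ?thesis
    using upset[unfolded upset_on_def, rule_format, of S "insert (Suc k) S"] by (simp add: subset_insertI)
qed

lemma H_decomp: "H = base \<union> insert (Suc k) ` (base \<union> boundary)"
proof
  show "H \<subseteq> base \<union> insert (Suc k) ` (base \<union> boundary)"
  proof
    fix S assume S: "S \<in> H"
    show "S \<in> base \<union> insert (Suc k) ` (base \<union> boundary)"
    proof (cases "Suc k \<in> S")
      case True
      define T where "T = S - {Suc k}"
      have ST: "S = insert (Suc k) T" "Suc k \<notin> T" using True by (auto simp: T_def)
      moreover have "T \<subseteq> {1..k}"
        using ground S unfolding T_def by (auto simp: atLeastAtMostSuc_conv)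
      ultimately have "T \<in> base \<union> boundary" using S by (auto simp: base_def boundary_def)
      then have "insert (Suc k) T \<in> insert (Suc k) ` (base \<union> boundary)" by (rule imageI)
      then show ?thesis unfolding ST(1) by (rule UnI2)
    qed (use S in \<open>simp add: base_def\<close>)
  qed
  show "base \<union> insert (Suc k) ` (base \<union> boundary) \<subseteq> H"
  proof -
    have "base \<subseteq> H" "insert (Suc k) ` boundary \<subseteq> H" by (auto simp: base_def boundary_def)
    then show ?thesis using insert_base by blast
  qed
qed

lemma weight_split:
  "family_weight (Suc k) q H = family_weight k (Suc q) base + (\<Sum>S\<in>boundary. semifree (k - card S) q)"
proof -
  have boundary: "Suc k \<notin> S" "finite S" if "S \<in> boundary" for S
    using boundary_subset[OF that] finite_subset by auto
  then have "inj_on (insert (Suc k)) boundary"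
    by (intro inj_onI) (metis insert_ident)
  then have "(\<Sum>S\<in>insert (Suc k) ` boundary. semifree (Suc k - card S) q) = (\<Sum>S\<in>boundary. semifree (k - card S) q)"
    using boundary by (simp add: sum.reindex)
  moreover have "family_weight (Suc k) q (base \<union> insert (Suc k) ` base) = family_weight k (Suc q) base"
    using base_subset by (intro family_weight_Suc) auto
  moreover have "family_weight (Suc k) q H
      = family_weight (Suc k) q (base \<union> insert (Suc k) ` base) + (\<Sum>S\<in>insert (Suc k) ` boundary. semifree (Suc k - card S) q)"
  proof -
    have "insert (Suc k) S \<noteq> insert (Suc k) T" if "S \<in> base" "T \<in> boundary" for S T
    proof
      assume eq: "insert (Suc k) S = insert (Suc k) T"
      have "Suc k \<notin> S" using that(1) by (simp add: base_def)
      then have "S = T" using eq boundary(1)[OF that(2)] by (metis insert_ident)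
      then show False using that base_boundary_disjoint by blast
    qed
    then have "(base \<union> insert (Suc k) ` base) \<inter> insert (Suc k) ` boundary = {}"
      by (auto simp: base_def)
    moreover have "H = (base \<union> insert (Suc k) ` base) \<union> insert (Suc k) ` boundary"
      using H_decomp by (simp add: image_Un Un_assoc)
    ultimately show ?thesis
      unfolding family_weight_def by (metis finite_Un finite_base finite_boundary finite_imageI sum.union_disjoint)
  qed
  ultimately show ?thesis by simp
qed

text \<open>If \<open>i\<close> were missed by both sets, moving \<open>Suc k\<close> to \<open>i\<close> in one of them would leave too small an
  intersection.\<close>

lemma conflict:
  assumes S: "S \<in> boundary" and T: "T \<in> boundary" and less: "card (S \<inter> T) < t"
  shows "S \<union> T = {1..k}" and "(k - card S) + (k - card T) = N"
proof -
  have sub: "S \<subseteq> {1..k}" "T \<subseteq> {1..k}" using S T boundary_subset by auto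
  then have fin: "finite S" "finite T" using finite_subset by auto
  have notk: "Suc k \<notin> S" "Suc k \<notin> T" using sub by auto
  have ins: "insert (Suc k) S \<in> H" "insert (Suc k) T \<in> H" using S T by (auto simp: boundary_def)
  show un: "S \<union> T = {1..k}"
  proof (rule ccontr)
    assume "S \<union> T \<noteq> {1..k}"
    then obtain i where "i \<in> {1..k}" "i \<notin> S" "i \<notin> T" using sub by blast
    then have i: "1 \<le> i" "i \<le> k" "i \<notin> S" "i \<notin> T" by auto
    then have "replace i (Suc k) (insert (Suc k) S) \<in> H"
      using shifted ins(1) unfolding left_shifted_def by auto
    then have "t \<le> card (replace i (Suc k) (insert (Suc k) S) \<inter> insert (Suc k) T)"
      using int ins(2) unfolding set_t_intersecting_def by blast
    also have "replace i (Suc k) (insert (Suc k) S) \<inter> insert (Suc k) T = S \<inter> T"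
      using i notk by (auto simp: replace_def)
    finally show False using less by simp
  qed
  have "t \<le> card (insert (Suc k) S \<inter> insert (Suc k) T)"
    using int ins unfolding set_t_intersecting_def by blast
  also have "\<dots> = Suc (card (S \<inter> T))"
    using fin notk by simp
  finally have "card (S \<inter> T) = t - 1" using less by simp
  then have "card S + card T = k + (t - 1)"
    using card_Un_Int[OF fin] un by simp
  then show "(k - card S) + (k - card T) = N"
    using boundary_card_le[OF S] boundary_card_le[OF T] t_pos t_le unfolding N_def by linarith
qed

lemma top_level:
  assumes "level 0 \<noteq> {}" "a \<noteq> 0"
  shows "level a = {}"
proof (rule ccontr)
  assume "level a \<noteq> {}"
  then obtain T where T: "T \<in> boundary" "card T < k" using assms(2) by (auto simp: level_def)
  obtain S where S: "S \<in> boundary" "card S \<ge> k" using assms(1) by (auto simp: level_def)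
  then have "S = {1..k}"
    using card_seteq[OF _ boundary_subset[OF S(1)]] by simp
  then have full: "{1..k} \<notin> H" using S by (simp add: boundary_def)
  have "T \<noteq> {1..k}" using T by auto
  then obtain i where "i \<in> {1..k}" "i \<notin> T" using boundary_subset[OF T(1)] by blast
  then have i: "1 \<le> i" "i \<le> k" "i \<notin> T" by auto
  then have "replace i (Suc k) (insert (Suc k) T) \<in> H"
    using shifted T(1) unfolding left_shifted_def boundary_def by auto
  moreover have "replace i (Suc k) (insert (Suc k) T) \<subseteq> {1..k}"
    using boundary_subset[OF T(1)] i by (auto simp: replace_def)
  ultimately show False using full upset unfolding upset_on_def by auto
qed

text \<open>A base set avoids \<open>Suc k\<close>, so adding that point to a boundary set does not
  change their intersection. Conflicts arise only inside the boundary.\<close>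

lemma kept_intersecting:
  assumes "K \<subseteq> boundary" "\<And>S T. S \<in> K \<Longrightarrow> T \<in> K \<Longrightarrow> t \<le> card (S \<inter> T)"
  shows "set_t_intersecting t (base \<union> K)"
proof -
  have mixed: "t \<le> card (S \<inter> T)" if "S \<in> base" "T \<in> K" for S T
  proof -
    have "t \<le> card (S \<inter> insert (Suc k) T)"
      using int that assms(1) unfolding set_t_intersecting_def base_def boundary_def by blast
    also have "S \<inter> insert (Suc k) T = S \<inter> T" using that by (auto simp: base_def)
    finally show ?thesis .
  qed
  moreover have "t \<le> card (S \<inter> T)" if "S \<in> base" "T \<in> base" for S T
    using int that unfolding set_t_intersecting_def base_def by blast
  moreover have "t \<le> card (T \<inter> S)" if "S \<in> base" "T \<in> K" for S T
    using mixed[OF that] by (simp add: Int_commute)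
  ultimately show ?thesis
    using assms(2) unfolding set_t_intersecting_def by blast
qed

lemma sum_boundary_levels:
  "(\<Sum>S | S \<in> boundary \<and> P (k - card S). \<phi> (k - card S)) = (\<Sum>a | a \<le> k \<and> P a. card (level a) * \<phi> a)"
proof -
  have "(\<Sum>a | a \<le> k \<and> P a. card (level a) * \<phi> a)
      = (\<Sum>a | a \<le> k \<and> P a. \<Sum>S\<in>{S \<in> {S\<in>boundary. P (k - card S)}. k - card S = a}. \<phi> (k - card S))"
  proof (intro sum.cong refl)
    fix a assume "a \<in> {a. a \<le> k \<and> P a}"
    then have "{S \<in> {S\<in>boundary. P (k - card S)}. k - card S = a} = level a"
      by (auto simp: level_def)
    moreover have "(\<Sum>S\<in>level a. \<phi> (k - card S)) = (\<Sum>S\<in>level a. \<phi> a)"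
      by (intro sum.cong refl) (simp add: level_def)
    ultimately show "card (level a) * \<phi> a
        = (\<Sum>S\<in>{S \<in> {S\<in>boundary. P (k - card S)}. k - card S = a}. \<phi> (k - card S))"
      by simp
  qed
  also have "\<dots> = (\<Sum>S | S \<in> boundary \<and> P (k - card S). \<phi> (k - card S))"
    by (rule sum.group) auto
  finally show ?thesis ..
qed

text \<open>Keeping a boundary set raises its weight from \<open>semifree a q\<close> to
  \<open>semifree a (Suc q)\<close>. Conflicting sets cover \<open>{1..k}\<close>, so middle sets
  that all miss one point \<open>i\<close> can be kept together; \<open>i\<close> remains free for
  averaging.\<close>

lemma exchange_middle:
  assumes M: "\<And>H'. H' \<subseteq> Pow {1..k} \<Longrightarrow> set_t_intersecting t H' \<Longrightarrow> family_weight k (Suc q) H' \<le> M"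
    and i: "i \<in> {1..k}"
  shows "family_weight (Suc k) q H
      + card {S\<in>boundary. 2 * (k - card S) = N \<and> i \<notin> S} * semifree (N div 2) (Suc q)
    \<le> M + card {S\<in>boundary. 2 * (k - card S) = N} * semifree (N div 2) q"
proof -
  define f where "f a = card (level a) * semifree a q" for a
  define h where "h a = card (level a) * semifree (Suc a) q" for a
  have alt: "f (N - a) \<le> h a \<or> f a \<le> h (N - a)" if "a \<le> N" "2 * a \<noteq> N" for a
  proof -
    have step: "f a \<le> h a" if "a \<noteq> 0" for a
      using semifree_mono[of a q] that by (simp add: f_def h_def)
    have zero: "f a \<le> h b \<or> f b \<le> h a" if "a \<noteq> b" "a = 0" for a b
      using top_level[of b] that by (cases "level 0 = {}") (auto simp: f_def)
    show ?thesis
    proof (cases "a = 0 \<or> N - a = 0")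
      case True
      then show ?thesis using zero[of a "N - a"] zero[of "N - a" a] that by auto
    next
      case False
      \<comment> \<open>If both alternatives failed, then with \<open>b = N - a\<close> one would
        get \<open>f a \<le> h a < f b \<le> h b < f a\<close>.\<close>
      then show ?thesis using step[of a] step[of "N - a"] by linarith
    qed
  qed
  have "N \<le> k" using t_pos by (simp add: N_def)
  obtain I where I: "\<And>a b. a \<in> I \<Longrightarrow> b \<in> I \<Longrightarrow> a + b \<noteq> N"
    and le: "(\<Sum>a | a \<le> k \<and> 2 * a \<noteq> N. f a) \<le> (\<Sum>a | a \<le> k \<and> a \<in> I. f a + h a)"
    using select_indices[OF \<open>N \<le> k\<close>, of f h, OF alt] by blast
  define K1 where "K1 = {S. S \<in> boundary \<and> k - card S \<in> I}"
  define K2 where "K2 = {S\<in>boundary. 2 * (k - card S) = N \<and> i \<notin> S}"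
  have sub: "K1 \<union> K2 \<subseteq> boundary" by (auto simp: K1_def K2_def)
  have disj: "K1 \<inter> K2 = {}" using I by (fastforce simp: K1_def K2_def)
  have "set_t_intersecting t (base \<union> (K1 \<union> K2))"
  proof (rule kept_intersecting[OF sub], rule ccontr)
    fix S T assume ST: "S \<in> K1 \<union> K2" "T \<in> K1 \<union> K2" and "\<not> t \<le> card (S \<inter> T)"
    then have conf: "S \<union> T = {1..k}" "(k - card S) + (k - card T) = N"
      using conflict[of S T] sub by auto
    have "i \<in> S \<union> T" using conf i by simp
    moreover have "\<not> (S \<in> K1 \<and> T \<in> K1)" using I conf by (auto simp: K1_def)
    moreover have "S \<in> K1 \<longleftrightarrow> T \<in> K1"
    proof -
      have "k - card S = k - card T" if "S \<in> K2 \<or> T \<in> K2"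
        using that conf(2) by (auto simp: K2_def)
      then show ?thesis using ST sub by (auto simp: K1_def)
    qed
    ultimately show False using ST by (auto simp: K2_def)
  qed
  moreover have "base \<union> (K1 \<union> K2) \<subseteq> Pow {1..k}"
    using sub base_subset boundary_subset by blast
  ultimately have "family_weight k (Suc q) (base \<union> (K1 \<union> K2)) \<le> M"
    by (rule M[rotated])
  moreover have "finite K1" "finite K2"
    using finite_subset[OF _ finite_boundary] sub by auto
  moreover have "base \<inter> (K1 \<union> K2) = {}" using base_boundary_disjoint sub by blast
  ultimately have 1: "family_weight k (Suc q) base + (\<Sum>S\<in>K1. semifree (k - card S) (Suc q))
      + (\<Sum>S\<in>K2. semifree (k - card S) (Suc q)) \<le> M"
    using disj by (simp add: family_weight_def sum.union_disjoint del: semifree.simps)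
  have half: "k - card S = N div 2" if "2 * (k - card S) = N" for S :: "nat set"
    using that by (metis nonzero_mult_div_cancel_left zero_neq_numeral)
  have "(\<Sum>S\<in>K2. semifree (k - card S) (Suc q)) = (\<Sum>S\<in>K2. semifree (N div 2) (Suc q))"
  proof (intro sum.cong refl)
    fix S assume "S \<in> K2"
    then have "k - card S = N div 2" by (intro half) (simp add: K2_def)
    then show "semifree (k - card S) (Suc q) = semifree (N div 2) (Suc q)" by (simp only:)
  qed
  then have 2: "(\<Sum>S\<in>K2. semifree (k - card S) (Suc q)) = card K2 * semifree (N div 2) (Suc q)"
    by (simp del: semifree.simps)
  have 3: "(\<Sum>S\<in>K1. semifree (k - card S) (Suc q)) = (\<Sum>a | a \<le> k \<and> a \<in> I. f a + h a)"
    unfolding K1_def sum_boundary_levels[where P = "\<lambda>a. a \<in> I" and \<phi> = "\<lambda>a. semifree a (Suc q)"]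
    by (simp add: f_def h_def algebra_simps)
  have "boundary = {S. S \<in> boundary \<and> 2 * (k - card S) \<noteq> N} \<union> {S\<in>boundary. 2 * (k - card S) = N}" by auto
  then have "(\<Sum>S\<in>boundary. semifree (k - card S) q)
    = (\<Sum>S | S \<in> boundary \<and> 2 * (k - card S) \<noteq> N. semifree (k - card S) q)
      + (\<Sum>S | S \<in> boundary \<and> 2 * (k - card S) = N. semifree (k - card S) q)"
    by (subst sum.union_disjoint[symmetric]) (auto intro!: sum.cong)
  also have "(\<Sum>S | S \<in> boundary \<and> 2 * (k - card S) \<noteq> N. semifree (k - card S) q)
      = (\<Sum>a | a \<le> k \<and> 2 * a \<noteq> N. f a)"
    unfolding f_def by (rule sum_boundary_levels)
  also have "(\<Sum>S | S \<in> boundary \<and> 2 * (k - card S) = N. semifree (k - card S) q)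
      = (\<Sum>S | S \<in> boundary \<and> 2 * (k - card S) = N. semifree (N div 2) q)"
  proof (intro sum.cong refl)
    fix S assume "S \<in> {S \<in> boundary. 2 * (k - card S) = N}"
    then have "k - card S = N div 2" by (intro half) simp
    then show "semifree (k - card S) q = semifree (N div 2) q" by (simp only:)
  qed
  finally have 4: "(\<Sum>S\<in>boundary. semifree (k - card S) q)
      = (\<Sum>a | a \<le> k \<and> 2 * a \<noteq> N. f a) + card {S\<in>boundary. 2 * (k - card S) = N} * semifree (N div 2) q"
    by simp
  show ?thesis
    unfolding weight_split 4 K2_def[symmetric] using le 1[unfolded 2 3] by linarith
qed

lemma weight_odd:
  assumes M: "\<And>H'. H' \<subseteq> Pow {1..k} \<Longrightarrow> set_t_intersecting t H' \<Longrightarrow> family_weight k (Suc q) H' \<le> M"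
    and "odd (Suc k - t)"
  shows "family_weight (Suc k) q H \<le> M"
proof -
  have "2 * (k - card S) \<noteq> N" for S :: "nat set"
    using assms(2) unfolding N_def[symmetric] by (metis dvd_triv_left)
  then have "{S\<in>boundary. 2 * (k - card S) = N} = {}" "{S\<in>boundary. 2 * (k - card S) = N \<and> 1 \<notin> S} = {}"
    by simp_all
  moreover have "1 \<in> {1..k}" using t_pos t_le by simp
  ultimately show ?thesis using exchange_middle[OF M, of 1] by (simp only: card.empty mult_0 add_0_right)
qed

text \<open>Some point is missed by a share of at least \<open>r / k\<close> of the middle level, as
  each of its sets misses \<open>r\<close> of the \<open>k\<close> points. Multiplying by
  \<open>k\<close> avoids division.\<close>

lemma weight_even:
  assumes M: "\<And>H'. H' \<subseteq> Pow {1..k} \<Longrightarrow> set_t_intersecting t H' \<Longrightarrow> family_weight k (Suc q) H' \<le> M"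
    and r: "Suc k = t + 2 * r"
  shows "k * family_weight (Suc k) q H + card (level r) * (r * semifree r (Suc q))
    \<le> k * M + card (level r) * (k * semifree r q)"
proof -
  have N: "N = 2 * r" using r by (simp add: N_def)
  have lev: "{S\<in>boundary. 2 * (k - card S) = N} = level r"
    by (auto simp: N level_def)
  have "\<exists>i\<in>{1..k}. r * card (level r) \<le> card {1..k} * card {S\<in>level r. i \<notin> S}"
  proof (rule exists_often_missed)
    show "{1..k} \<noteq> {}" using t_pos t_le by simp
  qed (auto simp: level_def boundary_def)
  then obtain i where i: "i \<in> {1..k}" "r * card (level r) \<le> k * card {S\<in>level r. i \<notin> S}"
    by auto
  have eq: "{S\<in>boundary. 2 * (k - card S) = N \<and> i \<notin> S} = {S\<in>level r. i \<notin> S}"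
    by (auto simp: N level_def)
  define s where "s = semifree r (Suc q)"
  have "family_weight (Suc k) q H + card {S\<in>level r. i \<notin> S} * s \<le> M + card (level r) * semifree r q"
    using exchange_middle[OF M i(1)] unfolding lev eq by (simp only: N s_def) simp
  then have "k * (family_weight (Suc k) q H + card {S\<in>level r. i \<notin> S} * s) \<le> k * (M + card (level r) * semifree r q)"
    by simp
  moreover have "(r * card (level r)) * s \<le> (k * card {S\<in>level r. i \<notin> S}) * s"
    using i(2) by (rule mult_right_mono) simp
  ultimately have "k * family_weight (Suc k) q H + (r * card (level r)) * s \<le> k * (M + card (level r) * semifree r q)"
    unfolding distrib_left by (simp only: mult.assoc)
  then show ?thesis unfolding s_def[symmetric] by (simp add: algebra_simps)
qed

lemma card_middle_layer:
  assumes "Suc k = t + 2 * r"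
  shows "card {S. S \<subseteq> {1..k} \<and> card S = k - r} = k choose r"
proof -
  have "r \<le> k" using assms t_pos by linarith
  then show ?thesis by (simp add: n_subsets binomial_symmetric[symmetric])
qed

lemma level_subset:
  assumes "Suc k = t + 2 * r"
  shows "level r \<subseteq> {S. S \<subseteq> {1..k} \<and> card S = k - r}"
  using boundary_subset boundary_card_le by (force simp: level_def)

lemma card_level_le:
  assumes "Suc k = t + 2 * r"
  shows "card (level r) \<le> k choose r"
proof -
  have "card (level r) \<le> card {S. S \<subseteq> {1..k} \<and> card S = k - r}"
    by (rule card_mono[OF _ level_subset[OF assms]]) simp
  also have "\<dots> = k choose r"
    by (rule card_middle_layer[OF assms])
  finally show ?thesis .
qed

text \<open>A complete middle level is rich enough to contain a set that nearly avoids any smaller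
  member of \<open>H\<close>. Needed only in the exceptional case, to put the family inside a
  candidate.\<close>

lemma full_level:
  assumes r: "Suc k = t + 2 * r" and full: "card (level r) = k choose r" and S: "S \<in> H"
  shows "t + r \<le> card S"
proof (rule ccontr)
  assume "\<not> t + r \<le> card S"
  have "level r = {S. S \<subseteq> {1..k} \<and> card S = k - r}"
    using full card_middle_layer[OF r] by (intro card_subset_eq level_subset[OF r]) simp_all
  then have lev: "U \<in> boundary" if "U \<subseteq> {1..k}" "card U = k - r" for U
    using that by (auto simp: level_def)
  define S' where "S' = S - {Suc k}"
  have sub: "S' \<subseteq> {1..k}" using ground S by (auto simp: S'_def atLeastAtMostSuc_conv)
  then have finS: "finite S'" using finite_subset by auto
  have S'_less: "card S' < t + r" if "Suc k \<notin> S"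
    using \<open>\<not> t + r \<le> card S\<close> that by (simp add: S'_def)
  have S'_less2: "Suc (card S') < t + r" if "Suc k \<in> S"
    using \<open>\<not> t + r \<le> card S\<close> that finS card_Suc_Diff1[of S "Suc k"] by (simp add: S'_def)
  have cS': "card S' \<le> t + r - 1" using S'_less S'_less2 by fastforce
  \<comment> \<open>\<open>V\<close> avoids \<open>S'\<close>, and \<open>W\<close> meets it in at
    most \<open>t - 1\<close> points. The sizes fit because
    \<open>r + (t - 1) = k - r\<close>.\<close>
  have "r \<le> card ({1..k} - S')" using r sub finS cS' t_pos by (simp add: card_Diff_subset)
  then obtain V where V: "V \<subseteq> {1..k} - S'" "card V = r" by (meson obtain_subset_with_card_n)
  have finV: "finite V" using V finite_subset by blast
  have "t - 1 \<le> card ({1..k} - V)" using r V t_pos finV by (subst card_Diff_subset) auto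
  then obtain W where W: "W \<subseteq> {1..k} - V" "card W = t - 1" by (meson obtain_subset_with_card_n)
  have finW: "finite W" using W finite_subset by blast
  define U where "U = V \<union> W"
  have U: "U \<subseteq> {1..k}" "card U = k - r"
  proof -
    show "U \<subseteq> {1..k}" using V W unfolding U_def by blast
    have "V \<inter> W = {}" using W by blast
    then show "card U = k - r"
      using V W finV finW r t_pos unfolding U_def by (simp add: card_Un_disjoint)
  qed
  have "S' \<inter> U \<subseteq> W" using V by (auto simp: U_def)
  then have "card (S' \<inter> U) \<le> card W" by (rule card_mono[OF finW])
  then have less: "card (S' \<inter> U) < t" using W(2) t_pos by linarith
  have U_boundary: "U \<in> boundary" using lev U by simp
  show False
  proof (cases "S' \<in> H")
    case True
    then have "t \<le> card (S' \<inter> insert (Suc k) U)"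
      using int U_boundary unfolding set_t_intersecting_def boundary_def by blast
    moreover have "S' \<inter> insert (Suc k) U = S' \<inter> U" by (auto simp: S'_def)
    ultimately show False using less by simp
  next
    case False
    then have "Suc k \<in> S" using S by (metis Diff_empty Diff_insert0 S'_def)
    then have "insert (Suc k) S' = S" by (auto simp: S'_def)
    then have "S' \<in> boundary" using False S sub by (simp add: boundary_def)
    \<comment> \<open>The conflict forces \<open>card S' = k - r = t + r - 1\<close>, so
      \<open>S\<close> would have \<open>t + r\<close> elements.\<close>
    then have "(k - card S') + (k - card U) = N"
      using conflict(2)[OF _ U_boundary less] by simp
    then show False using S'_less2[OF \<open>Suc k \<in> S\<close>] U r t_pos by (simp add: N_def)
  qed
qed

end

subsection \<open>The complete intersection theorem for the weighted families\<close>

text \<open>\<open>a\<close> counts the points of \<open>{1..t + 2 * r}\<close> that are missing,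
  and \<open>a \<le> r\<close> says that at least \<open>t + r\<close> are present.\<close>

definition frankl_weight :: "nat \<Rightarrow> nat \<Rightarrow> nat \<Rightarrow> nat" where
  "frankl_weight t r q = (\<Sum>a\<le>r. (t + 2 * r choose a) * semifree a q)"

lemma family_weight_large_sets:
  assumes "r \<le> m"
  shows "family_weight m q {S. S \<subseteq> {1..m} \<and> m - r \<le> card S} = (\<Sum>a\<le>r. (m choose a) * semifree a q)"
proof -
  let ?H = "{S. S \<subseteq> {1..m} \<and> m - r \<le> card S}"
  have "(\<Sum>a\<le>r. (m choose a) * semifree a q) = (\<Sum>a\<le>r. \<Sum>S\<in>{S\<in>?H. m - card S = a}. semifree (m - card S) q)"
  proof (intro sum.cong refl)
    fix a assume a: "a \<in> {..r}"
    have "card S \<le> m" if "S \<subseteq> {1..m}" for S using card_mono[OF _ that] by simp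
    then have eq: "{S\<in>?H. m - card S = a} = {S. S \<subseteq> {1..m} \<and> card S = m - a}"
      using a assms by fastforce
    have "card {S\<in>?H. m - card S = a} = m choose a"
      unfolding eq using a assms by (simp add: n_subsets binomial_symmetric[symmetric])
    moreover have "(\<Sum>S\<in>{S\<in>?H. m - card S = a}. semifree (m - card S) q) = (\<Sum>S\<in>{S\<in>?H. m - card S = a}. semifree a q)"
      by (intro sum.cong refl) simp
    ultimately show "(m choose a) * semifree a q = (\<Sum>S\<in>{S\<in>?H. m - card S = a}. semifree (m - card S) q)"
      by simp
  qed
  also have "\<dots> = (\<Sum>S\<in>?H. semifree (m - card S) q)"
  proof (rule sum.group)
    show "finite ?H" by (rule finite_subset[of _ "Pow {1..m}"]) auto
  qed auto
  finally show ?thesis by (simp add: family_weight_def)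
qed

text \<open>Seen on \<open>t + 2 * r + 2\<close> coordinates, the next candidate loses the sets that
  miss \<open>r\<close> old and both new coordinates and gains those that miss \<open>r + 1\<close>
  old ones and contain both new ones. The proof applies Pascal's rule twice.\<close>

lemma frankl_weight_Suc:
  "frankl_weight t (Suc r) q + (t + 2 * r choose r) * semifree (Suc (Suc r)) q
    = frankl_weight t r (Suc (Suc q)) + (t + 2 * r choose Suc r) * semifree (Suc r) q"
proof -
  define M where "M = t + 2 * r"
  define s where "s a = semifree a q" for a
  have pascal: "(\<Sum>a\<le>Suc n. (Suc m choose a) * u a) + (m choose Suc n) * u (Suc (Suc n))
      = (\<Sum>a\<le>Suc n. (m choose a) * (u a + u (Suc a)))" for m n and u :: "nat \<Rightarrow> nat"
  proof -
    have "(\<Sum>a\<le>Suc n. (Suc m choose a) * u a) = u 0 + (\<Sum>a\<le>n. (m choose Suc a) * u (Suc a)) + (\<Sum>a\<le>n. (m choose a) * u (Suc a))"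
      by (simp add: sum.atMost_Suc_shift sum.distrib algebra_simps del: sum.atMost_Suc)
    also have "u 0 + (\<Sum>a\<le>n. (m choose Suc a) * u (Suc a)) = (\<Sum>a\<le>Suc n. (m choose a) * u a)"
      by (simp add: sum.atMost_Suc_shift del: sum.atMost_Suc)
    finally show ?thesis by (simp add: sum.distrib algebra_simps)
  qed
  have 1: "frankl_weight t (Suc r) q + (Suc M choose Suc r) * s (Suc (Suc r))
      = (\<Sum>a\<le>Suc r. (Suc M choose a) * (s a + s (Suc a)))"
    using pascal[where n = r and m = "Suc M" and u = s] by (simp add: frankl_weight_def M_def s_def del: sum.atMost_Suc binomial_Suc_Suc)
  have 2: "(\<Sum>a\<le>Suc r. (Suc M choose a) * (s a + s (Suc a))) + (M choose Suc r) * (s (Suc (Suc r)) + s (Suc (Suc (Suc r))))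
      = (\<Sum>a\<le>Suc r. (M choose a) * (s a + s (Suc a) + (s (Suc a) + s (Suc (Suc a)))))"
    using pascal[where n = r and m = M and u = "\<lambda>a. s a + s (Suc a)"] by simp
  have 3: "(\<Sum>a\<le>Suc r. (M choose a) * (s a + s (Suc a) + (s (Suc a) + s (Suc (Suc a)))))
      = frankl_weight t r (Suc (Suc q)) + (M choose Suc r) * (s (Suc r) + s (Suc (Suc r)) + (s (Suc (Suc r)) + s (Suc (Suc (Suc r)))))"
    by (simp add: frankl_weight_def M_def s_def)
  show ?thesis
    using 1 2 3 unfolding M_def[symmetric] s_def[symmetric] by (simp add: algebra_simps)
qed

text \<open>Absorption identities bring the comparison into the shape of \<open>weight_even\<close>,
  with the middle level at its largest possible size \<open>k choose Suc r\<close>.\<close>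

lemma frankl_weight_step:
  assumes "Suc k = t + 2 * Suc r"
  shows "k * frankl_weight t (Suc r) q + (k choose Suc r) * (Suc r * semifree (Suc r) (Suc q))
    = k * frankl_weight t r (Suc (Suc q)) + (k choose Suc r) * (k * semifree (Suc r) q)"
proof -
  define M where "M = t + 2 * r"
  have k: "k = Suc M" using assms by (simp add: M_def)
  have c1: "k * (M choose r) = (k choose Suc r) * Suc r"
    using Suc_times_binomial[of r M] k by (simp add: mult.commute)
  have "k * (k choose Suc r) = k * (M choose r) + k * (M choose Suc r)"
    unfolding k by (simp add: algebra_simps)
  then have c2: "k * (M choose Suc r) + (k choose Suc r) * Suc r = k * (k choose Suc r)"
    using c1 by simp
  define A B S T where "A = frankl_weight t (Suc r) q" and "B = frankl_weight t r (Suc (Suc q))"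
    and "S = semifree (Suc r) q" and "T = semifree (Suc (Suc r)) q"
  have "k * (A + (M choose r) * T) = k * (B + (M choose Suc r) * S)"
    using frankl_weight_Suc[of t r q] by (simp add: A_def B_def S_def T_def M_def)
  then have "k * A + ((k choose Suc r) * Suc r) * T = k * B + (k * (M choose Suc r)) * S"
    unfolding c1[symmetric] by (simp only: distrib_left mult.assoc)
  then have "k * A + ((k choose Suc r) * Suc r) * T + ((k choose Suc r) * Suc r) * S
      = k * B + (k * (M choose Suc r) + (k choose Suc r) * Suc r) * S"
    by (simp only: distrib_right)
  then have "k * A + (k choose Suc r) * (Suc r * (S + T)) = k * B + (k choose Suc r) * (k * S)"
    unfolding c2 by (simp add: algebra_simps)
  then show ?thesis by (simp add: A_def B_def S_def T_def)
qed

lemma level_drop_propagates: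
  assumes "1 \<le> t" "1 \<le> i" "i \<le> r" "t + 2 * r \<le> n" "level_drop t i (n - t - 2 * i)" "\<not> (n = 6 \<and> t = 2)"
  shows "level_drop t r (n - t - 2 * r)"
  using assms(3,4)
proof (induction r rule: dec_induct)
  case (step r)
  define p where "p = n - t - 2 * Suc r"
  have p: "n - t - 2 * r = Suc (Suc p)" using step.prems by (simp add: p_def)
  have drop: "level_drop t r (Suc (Suc p))" using step p by simp
  show ?case
  proof (cases "p = 0")
    case True
    have "level_drop t (Suc r) 0"
    proof (rule level_drop_Suc_0[OF assms(1)])
      show "1 \<le> r" using step assms(2) by simp
      show "t \<noteq> 2" if "r = 1" using that True step.prems assms(6) by (auto simp: p_def)
      show "level_drop t r 2" using drop True by (simp add: numeral_2_eq_2)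
    qed
    then show ?thesis using True by (simp add: p_def)
  next
    case False
    then show ?thesis using level_drop_Suc_pos[OF assms(1) _ drop] by (simp add: p_def)
  qed
qed (use assms in simp)

lemma frankl_weight_less:
  assumes "1 \<le> t" "t + 2 * Suc r \<le> n" "\<not> level_drop t (Suc r) (n - t - 2 * Suc r)"
  shows "frankl_weight t r (n - t - 2 * r) \<le> frankl_weight t (Suc r) (n - t - 2 * Suc r)"
proof -
  define q where "q = n - t - 2 * Suc r"
  define k where "k = t + 2 * r + 1"
  have q: "n - t - 2 * r = Suc (Suc q)" using assms(2) by (simp add: q_def)
  have "Suc r * semifree (Suc r) (Suc q) \<le> k * semifree (Suc r) q"
    using assms(3) unfolding level_drop_def q_def[symmetric] by (simp add: k_def)
  then have "(k choose Suc r) * (Suc r * semifree (Suc r) (Suc q)) \<le> (k choose Suc r) * (k * semifree (Suc r) q)"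
    by (rule mult_left_mono) simp
  moreover have "k * frankl_weight t (Suc r) q + (k choose Suc r) * (Suc r * semifree (Suc r) (Suc q))
    = k * frankl_weight t r (Suc (Suc q)) + (k choose Suc r) * (k * semifree (Suc r) q)"
    by (rule frankl_weight_step) (simp add: k_def)
  ultimately have "k * frankl_weight t r (Suc (Suc q)) \<le> k * frankl_weight t (Suc r) q" by linarith
  moreover have "0 < k" by (simp add: k_def)
  ultimately show ?thesis unfolding q q_def[symmetric] by simp
qed

text \<open>For \<open>n = 6\<close>, \<open>t = 2\<close> the weights are \<open>15, 14, 16\<close>: the only failure of unimodality.\<close>

lemma frankl_weight_6_2: "frankl_weight 2 0 4 = 15" "frankl_weight 2 1 2 = 14" "frankl_weight 2 2 0 = 16"
proof -
  have D: "sfree (Suc 0) = 0" "sfree (Suc (Suc 0)) = 1" "sfree (Suc (Suc (Suc 0))) = 1"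
    "sfree (Suc (Suc (Suc (Suc 0)))) = 4"
    using sfree_values by (simp_all add: numeral_eq_Suc)
  show "frankl_weight 2 0 4 = 15" "frankl_weight 2 1 2 = 14" "frankl_weight 2 2 0 = 16"
    by (simp_all add: frankl_weight_def D numeral_eq_Suc)
qed

lemma even_step:
  assumes t: "1 \<le> t" and k: "Suc k = t + 2 * Suc r" and n: "Suc k \<le> n"
    and H: "H \<subseteq> Pow {1..Suc k}" "set_t_intersecting t H"
    and IH: "\<And>H'. H' \<subseteq> Pow {1..k} \<Longrightarrow> set_t_intersecting t H' \<Longrightarrow>
      \<exists>i\<le>r. family_weight k (n - k) H' \<le> frankl_weight t i (n - t - 2 * i)"
  shows "\<exists>i\<le>Suc r. family_weight (Suc k) (n - Suc k) H \<le> frankl_weight t i (n - t - 2 * i)"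
proof -
  define q where "q = n - Suc k"
  define \<phi> where "\<phi> i = frankl_weight t i (n - t - 2 * i)" for i
  have q: "n - k = Suc q" "n - t - 2 * Suc r = q" "n - t - 2 * r = Suc (Suc q)" using n k by (simp_all add: q_def)
  define M where "M = Max (\<phi> ` {..r})"
  have M_in: "\<exists>i\<le>r. M = \<phi> i"
  proof -
    have "M \<in> \<phi> ` {..r}" unfolding M_def by (intro Max_in) auto
    then show ?thesis by auto
  qed
  have M: "family_weight k (Suc q) H' \<le> M" if "H' \<subseteq> Pow {1..k}" "set_t_intersecting t H'" for H'
  proof -
    have "\<exists>i\<le>r. family_weight k (Suc q) H' \<le> \<phi> i"
      using IH[OF that] unfolding q(1) \<phi>_def .
    then obtain i where i: "i \<le> r" "family_weight k (Suc q) H' \<le> \<phi> i"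
      by blast
    moreover have "\<phi> i \<le> M" using i(1) unfolding M_def by (intro Max_ge) auto
    ultimately show ?thesis by linarith
  qed
  obtain G where G: "G \<subseteq> Pow {1..Suc k}" "set_t_intersecting t G" "upset_on {1..Suc k} G" "left_shifted G"
    and HG: "family_weight (Suc k) q H \<le> family_weight (Suc k) q G"
    using exists_left_shifted_upset[OF H] by blast
  interpret shifted_family t k q G
    using t k G by unfold_locales auto
  define w where "w = family_weight (Suc k) q G"
  define g where "g = card (level (Suc r))"
  define x where "x = Suc r * semifree (Suc r) (Suc q)"
  define y where "y = k * semifree (Suc r) q"
  have main: "k * w + g * x \<le> k * M + g * y"
    using weight_even[OF M k] by (simp only: w_def g_def x_def y_def)
  have g_le: "g \<le> k choose Suc r" unfolding g_def by (rule card_level_le[OF k])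
  have k_pos: "0 < k" using t k by simp
  have "\<exists>i\<le>Suc r. w \<le> \<phi> i"
  proof (cases "level_drop t (Suc r) q")
    case True
    then have "y \<le> x" using k by (simp only: level_drop_def x_def y_def) simp
    then have "g * y \<le> g * x" by simp
    then have "k * w \<le> k * M" using main by linarith
    then have "w \<le> M" using k_pos by simp
    then show ?thesis using M_in by (meson le_SucI)
  next
    case False
    show ?thesis
    proof (cases "n = 6 \<and> t = 2 \<and> r = 1")
      case special: True
      then have k5: "k = 5" and q0: "q = 0" using k by (simp_all add: q_def)
      have phi: "\<phi> 0 = 15" "\<phi> 1 = 14" "\<phi> 2 = 16"
        using special frankl_weight_6_2 by (simp_all add: \<phi>_def)
      have "M \<le> 15" using M_in phi special by (auto simp: le_Suc_eq)
      have xy: "x = 4" "y = 5"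
        using sfree_values special by (simp_all add: x_def y_def k5 q0 numeral_eq_Suc)
      then have w: "5 * w \<le> 75 + g" using main \<open>M \<le> 15\<close> unfolding k5 xy by linarith
      \<comment> \<open>Here \<open>g \<le> 10\<close>. For \<open>g \<le> 9\<close> integrality
        gives \<open>w \<le> 16\<close>; for \<open>g = 10\<close> the inequality only gives 17, but
        then \<open>full_level\<close> places \<open>G\<close> inside the candidate of weight
        16.\<close>
      show ?thesis
      proof (cases "g = k choose Suc r")
        case True
        have "m - Suc r \<le> card S \<and> S \<subseteq> {1..m}" if "S \<in> G" "m = Suc k" for S m
          using full_level[OF k _ that(1)] True k G(1) that unfolding g_def by auto
        then have "w \<le> family_weight (Suc k) q {S. S \<subseteq> {1..Suc k} \<and> Suc k - Suc r \<le> card S}"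
          unfolding w_def family_weight_def by (intro sum_mono2) (auto intro: finite_subset[of _ "Pow {1..Suc k}"])
        also have "\<dots> = (\<Sum>a\<le>Suc r. (Suc k choose a) * semifree a q)"
          using k by (intro family_weight_large_sets) simp
        also have "\<dots> = \<phi> (Suc r)" by (simp only: \<phi>_def frankl_weight_def q k)
        finally show ?thesis by blast
      next
        case False
        have "k choose Suc r = 10" using special k5 by (simp add: numeral_eq_Suc)
        then have "g \<le> 9" using False g_le by linarith
        then have "w \<le> \<phi> 2" using w phi by linarith
        then show ?thesis using special by (intro exI[of _ 2]) simp
      qed
    next
      case not_special: False
      \<comment> \<open>An earlier drop would propagate to \<open>Suc r\<close>. Without one, the
        candidates increase up to \<open>Suc r\<close>, and \<open>M\<close> is the last value
        \<open>\<phi> r\<close>.\<close>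
      have no_drop: "\<not> level_drop t i (n - t - 2 * i)" if "1 \<le> i" "i \<le> Suc r" for i
      proof (cases "i = Suc r")
        case True
        show ?thesis unfolding True q by (rule False)
      next
        case i: False
        show ?thesis
        proof (cases "n = 6 \<and> t = 2")
          case True
          then have "r = 0 \<or> r = 1" using k n by auto
          then show ?thesis using not_special True that i by auto
        next
          case False2: False
          show ?thesis
            using level_drop_propagates[OF t that, of n] False False2 n k by (auto simp only: q)
        qed
      qed
      have mono: "\<phi> i \<le> \<phi> (Suc i)" if "i \<le> r" for i
        unfolding \<phi>_def using frankl_weight_less[OF t, of i n] no_drop[of "Suc i"] that n k by simp
      have "\<phi> i \<le> \<phi> r" if "i \<le> r" for i
        using that by (induction rule: inc_induct) (auto intro: order_trans[OF mono])
      then have "M = \<phi> r"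
        unfolding M_def by (intro Max_eqI) auto
      have "x \<le> y" using False k by (simp only: level_drop_def x_def y_def) simp
      then obtain z where z: "y = x + z" using le_Suc_ex by blast
      have "k * w \<le> k * M + g * z" using main by (simp add: z algebra_simps)
      also have "\<dots> \<le> k * M + (k choose Suc r) * z" using g_le by simp
      also have "\<dots> = k * \<phi> (Suc r)"
      proof -
        have "\<phi> r = frankl_weight t r (Suc (Suc q))" "\<phi> (Suc r) = frankl_weight t (Suc r) q"
          by (simp_all only: \<phi>_def q)
        then show ?thesis
          using frankl_weight_step[OF k, of q] z unfolding x_def[symmetric] y_def[symmetric]
          by (simp add: \<open>M = \<phi> r\<close> algebra_simps)
      qed
      finally have "w \<le> \<phi> (Suc r)" using k_pos by simp
      then show ?thesis by blast
    qed
  qed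
  then show ?thesis using HG unfolding w_def \<phi>_def q_def[symmetric] by (meson le_trans)
qed

lemma odd_step:
  fixes \<phi> :: "nat \<Rightarrow> nat"
  assumes t: "1 \<le> t" "t \<le> k" "odd (Suc k - t)" and n: "Suc k \<le> n"
    and H: "H \<subseteq> Pow {1..Suc k}" "set_t_intersecting t H"
    and IH: "\<And>H'. H' \<subseteq> Pow {1..k} \<Longrightarrow> set_t_intersecting t H' \<Longrightarrow>
      \<exists>i\<le>r. family_weight k (n - k) H' \<le> \<phi> i"
  shows "\<exists>i\<le>r. family_weight (Suc k) (n - Suc k) H \<le> \<phi> i"
proof -
  define q where "q = n - Suc k"
  have q: "n - k = Suc q" using n by (simp add: q_def)
  define M where "M = Max (\<phi> ` {..r})"
  have M_in: "\<exists>i\<le>r. M = \<phi> i"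
  proof -
    have "M \<in> \<phi> ` {..r}" unfolding M_def by (intro Max_in) auto
    then show ?thesis by auto
  qed
  have M: "family_weight k (Suc q) H' \<le> M" if "H' \<subseteq> Pow {1..k}" "set_t_intersecting t H'" for H'
  proof -
    have "\<exists>i\<le>r. family_weight k (Suc q) H' \<le> \<phi> i"
      using IH[OF that] unfolding q(1) .
    then obtain i where i: "i \<le> r" "family_weight k (Suc q) H' \<le> \<phi> i"
      by blast
    moreover have "\<phi> i \<le> M" using i(1) unfolding M_def by (intro Max_ge) auto
    ultimately show ?thesis by linarith
  qed
  obtain G where G: "G \<subseteq> Pow {1..Suc k}" "set_t_intersecting t G" "upset_on {1..Suc k} G" "left_shifted G"
    and HG: "family_weight (Suc k) q H \<le> family_weight (Suc k) q G"
    using exists_left_shifted_upset[OF H] by blast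
  interpret shifted_family t k q G
    using t G by unfold_locales auto
  have "family_weight (Suc k) q G \<le> M" by (rule weight_odd[OF M t(3)])
  then show ?thesis using HG M_in unfolding q_def[symmetric] by (meson le_trans)
qed

text \<open>The total number \<open>n\<close> of points is fixed while \<open>m\<close> grows, so
  the weight of a candidate does not change and the bounds for different \<open>m\<close> can be
  chained.\<close>

lemma family_weight_le:
  assumes t: "1 \<le> t" "t \<le> m" and n: "m \<le> n"
    and H: "H \<subseteq> Pow {1..m}" "set_t_intersecting t H"
  shows "\<exists>i\<le>(m - t) div 2. family_weight m (n - m) H \<le> frankl_weight t i (n - t - 2 * i)"
  using t(2) n H
proof (induction m arbitrary: H rule: dec_induct)
  case base
  have "S = {1..t}" if "S \<in> H" for S
  proof -
    have "S \<subseteq> {1..t}" "t \<le> card S" using base that unfolding set_t_intersecting_def by force+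
    then show ?thesis using card_seteq[of "{1..t}" S] by simp
  qed
  then have "H \<subseteq> {{1..t}}" by blast
  then have "family_weight t (n - t) H \<le> family_weight t (n - t) {{1..t}}"
    unfolding family_weight_def by (intro sum_mono2) auto
  also have "\<dots> = frankl_weight t 0 (n - t - 2 * 0)"
    by (simp add: family_weight_def frankl_weight_def)
  finally show ?case by auto
next
  case (step k)
  have IH: "\<exists>i\<le>(k - t) div 2. family_weight k (n - k) H' \<le> frankl_weight t i (n - t - 2 * i)"
    if "H' \<subseteq> Pow {1..k}" "set_t_intersecting t H'" for H'
    using step.IH[OF _ that] step.prems by simp
  show ?case
  proof (cases "even (Suc k - t)")
    case True
    define r where "r = (k - t) div 2"
    have k: "Suc k = t + 2 * Suc r" and r: "(Suc k - t) div 2 = Suc r"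
      using True step.hyps unfolding r_def by (auto elim!: evenE simp: Suc_diff_le) presburger+
    show ?thesis
      unfolding r
      by (rule even_step[OF t(1) k step.prems(1) step.prems(2,3)]) (use IH in \<open>simp add: r_def\<close>)
  next
    case False
    then have eq: "(Suc k - t) div 2 = (k - t) div 2"
      using step.hyps by (simp add: Suc_diff_le)
    show ?thesis
      unfolding eq by (rule odd_step[OF t(1) step.hyps(1) False step.prems]) (rule IH)
  qed
qed

subsection \<open>From set partitions to their fixed points\<close>

definition sfree_partitions :: "'a set \<Rightarrow> 'a set set set" where
  "sfree_partitions V = {p. partition_on V p \<and> (\<forall>B\<in>p. card B \<noteq> 1)}"

lemma partition_on_unique_block:
  "partition_on V p \<Longrightarrow> B \<in> p \<Longrightarrow> C \<in> p \<Longrightarrow> x \<in> B \<Longrightarrow> x \<in> C \<Longrightarrow> B = C"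
  by (auto simp: partition_on_def disjoint_def)

lemma finite_sfree_partitions: "finite V \<Longrightarrow> finite (sfree_partitions V)"
  unfolding sfree_partitions_def by (rule finite_subset[OF _ finitely_many_partition_on[of V]]) auto

text \<open>\<open>Z\<close> consists of the points outside the block of \<open>x\<close>; its being
  a proper subset of \<open>V\<close> says that this block is not \<open>{x}\<close>.\<close>

lemma sfree_partitions_insert:
  assumes "finite V" "x \<notin> V"
  shows "bij_betw (\<lambda>(Z, p). insert (insert x (V - Z)) p) (Sigma {Z. Z \<subset> V} sfree_partitions)
    (sfree_partitions (insert x V))"
    (is "bij_betw ?f ?D ?R")
proof -
  have xB: "{B \<in> insert (insert x (V - Z)) p. x \<in> B} = {insert x (V - Z)}"
    "{B \<in> insert (insert x (V - Z)) p. x \<notin> B} = p"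
    if "Z \<subset> V" "p \<in> sfree_partitions Z" for Z p
  proof -
    have "x \<notin> B" if "B \<in> p" for B
      using \<open>Z \<subset> V\<close> \<open>p \<in> _\<close> that assms(2) partition_onD1[of Z p] by (auto simp: sfree_partitions_def)
    then show "{B \<in> insert (insert x (V - Z)) p. x \<in> B} = {insert x (V - Z)}"
      "{B \<in> insert (insert x (V - Z)) p. x \<notin> B} = p" by auto
  qed
  have inj: "inj_on ?f ?D"
  proof (rule inj_onI)
    fix u v assume uv: "u \<in> ?D" "v \<in> ?D" "?f u = ?f v"
    obtain Z p Z' p' where pairs: "u = (Z, p)" "v = (Z', p')" by (cases u, cases v)
    have Z: "Z \<subset> V" "p \<in> sfree_partitions Z" "Z' \<subset> V" "p' \<in> sfree_partitions Z'"
      and eq: "insert (insert x (V - Z)) p = insert (insert x (V - Z')) p'"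
      using uv unfolding pairs by auto
    have "p = p'" by (rule trans[OF xB(2)[OF Z(1,2), unfolded eq, symmetric] xB(2)[OF Z(3,4)]])
    moreover have "Z = \<Union>p" "Z' = \<Union>p'"
      using Z partition_onD1 unfolding sfree_partitions_def by blast+
    ultimately show "u = v" by (simp add: pairs)
  qed
  have "?f ` ?D \<subseteq> ?R"
  proof (rule image_subsetI)
    fix u assume u: "u \<in> ?D"
    obtain Z p where pair: "u = (Z, p)" by (cases u)
    have Z: "Z \<subset> V" "p \<in> sfree_partitions Z" using u by (auto simp: pair)
    then have p: "partition_on Z p" "\<forall>B\<in>p. card B \<noteq> 1" by (auto simp: sfree_partitions_def)
    have "disjnt (insert x (V - Z)) (\<Union>p)"
      using partition_onD1[OF p(1)] Z(1) assms(2) by (auto simp: disjnt_def)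
    moreover have "insert x V - insert x (V - Z) = Z" using Z(1) assms(2) by auto
    ultimately have "partition_on (insert x V) (insert (insert x (V - Z)) p)"
      using p(1) Z(1) by (subst partition_on_insert) auto
    moreover have "card (insert x (V - Z)) \<noteq> 1"
      using assms Z(1) by (simp add: card_gt_0_iff)
    ultimately show "?f u \<in> sfree_partitions (insert x V)"
      using p(2) by (simp add: sfree_partitions_def pair)
  qed
  moreover have "?R \<subseteq> ?f ` ?D"
  proof
    fix q assume "q \<in> ?R"
    then have q: "partition_on (insert x V) q" "\<forall>B\<in>q. card B \<noteq> 1" by (auto simp: sfree_partitions_def)
    then obtain B where B: "B \<in> q" "x \<in> B" using partition_onD1[OF q(1)] by blast
    define Z where "Z = V - B"
    have sub: "B \<subseteq> insert x V" using partition_onD1[OF q(1)] B by blast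
    have eqB: "B = insert x (V - Z)" using sub B(2) assms(2) unfolding Z_def by blast
    have "disjnt B (\<Union>(q - {B}))"
      using partition_on_unique_block[OF q(1) B(1)] by (auto simp: disjnt_def)
    then have "partition_on (insert x V - B) (q - {B})"
      using q(1) B(1) partition_on_insert[of B "q - {B}" "insert x V"] by (simp add: insert_absorb)
    moreover have "insert x V - B = Z" using B(2) by (auto simp: Z_def)
    ultimately have p: "q - {B} \<in> sfree_partitions Z" using q(2) by (auto simp: sfree_partitions_def)
    have "B \<noteq> {x}" using q(2) B(1) by auto
    then obtain y where "y \<in> B" "y \<noteq> x" using B(2) by blast
    then have "Z \<subset> V" using sub unfolding Z_def by blast
    then have "(Z, q - {B}) \<in> ?D" using p by simp
    moreover have "q = ?f (Z, q - {B})" using B(1) eqB by auto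
    ultimately show "q \<in> ?f ` ?D" by blast
  qed
  ultimately show ?thesis using inj unfolding bij_betw_def by blast
qed

lemma card_sfree_partitions: "finite V \<Longrightarrow> card (sfree_partitions V) = sfree (card V)"
proof (induction "card V" arbitrary: V rule: less_induct)
  case less
  show ?case
  proof (cases "V = {}")
    case True
    then have "sfree_partitions V = {{}}" by (auto simp: sfree_partitions_def partition_on_empty)
    then show ?thesis using True by simp
  next
    case False
    then obtain x W where V: "V = insert x W" "x \<notin> W" by (meson Set.set_insert equals0I)
    then have fin: "finite W" and card_V: "card V = Suc (card W)" using less.prems by auto
    have fins: "finite {Z. Z \<subset> W}" by (rule finite_subset[of _ "Pow W"]) (use fin in auto)
    have "card (sfree_partitions V) = card (Sigma {Z. Z \<subset> W} sfree_partitions)"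
      using bij_betw_same_card[OF sfree_partitions_insert[OF fin V(2)]] V(1) by simp
    also have "\<dots> = (\<Sum>Z | Z \<subset> W. card (sfree_partitions Z))"
      using fin by (intro card_SigmaI fins ballI finite_sfree_partitions) (auto intro: finite_subset)
    also have "\<dots> = (\<Sum>Z | Z \<subset> W. sfree (card Z))"
    proof (intro sum.cong refl)
      fix Z assume "Z \<in> {Z. Z \<subset> W}"
      then show "card (sfree_partitions Z) = sfree (card Z)"
        using less.hyps[of Z] card_V psubset_card_mono[OF fin, of Z] fin finite_subset[of Z W] by auto
    qed
    also have "\<dots> = (\<Sum>k<card W. \<Sum>Z\<in>{Z\<in>{Z. Z \<subset> W}. card Z = k}. sfree (card Z))"
      by (rule sum.group[symmetric]) (use fins psubset_card_mono[OF fin] in auto)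
    also have "\<dots> = (\<Sum>k<card W. (card W choose k) * sfree k)"
    proof (intro sum.cong refl)
      fix k assume "k \<in> {..<card W}"
      then have eq: "{Z\<in>{Z. Z \<subset> W}. card Z = k} = {Z. Z \<subseteq> W \<and> card Z = k}" by auto
      have "(\<Sum>Z\<in>{Z. Z \<subseteq> W \<and> card Z = k}. sfree (card Z)) = (\<Sum>Z\<in>{Z. Z \<subseteq> W \<and> card Z = k}. sfree k)"
        by (intro sum.cong refl) simp
      then show "(\<Sum>Z\<in>{Z\<in>{Z. Z \<subset> W}. card Z = k}. sfree (card Z)) = (card W choose k) * sfree k"
        unfolding eq by (simp add: n_subsets fin)
    qed
    finally show ?thesis by (simp add: card_V sfree.simps(2))
  qed
qed

lemma card_partitions_fixed_points:
  assumes "S \<subseteq> {1..n}"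
  shows "card {p \<in> set_partitions n. fixed_points n p = S} = sfree (n - card S)"
proof -
  let ?s = "(\<lambda>i. {i}) ` S"
  let ?V = "{1..n} - S"
  have "bij_betw (\<lambda>p. p \<union> ?s) (sfree_partitions ?V) {p \<in> set_partitions n. fixed_points n p = S}"
  proof (rule bij_betw_byWitness[where f' = "\<lambda>p. p - ?s"])
    have disj: "p \<inter> ?s = {}" if "p \<in> sfree_partitions ?V" for p
      using that by (auto simp: sfree_partitions_def)
    show "\<forall>p\<in>sfree_partitions ?V. p \<union> ?s - ?s = p"
    proof
      fix p assume "p \<in> sfree_partitions ?V"
      then show "p \<union> ?s - ?s = p" using disj[of p] by (simp add: Un_Diff Diff_triv)
    qed
    have sing: "{i} \<in> p" if "p \<in> {p \<in> set_partitions n. fixed_points n p = S}" "i \<in> S" for i p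
      using that by (auto simp: fixed_points_def)
    show "\<forall>p\<in>{p \<in> set_partitions n. fixed_points n p = S}. p - ?s \<union> ?s = p"
    proof
      fix p assume "p \<in> {p \<in> set_partitions n. fixed_points n p = S}"
      then have "?s \<subseteq> p" using sing by blast
      then show "p - ?s \<union> ?s = p" by blast
    qed
    show "(\<lambda>p. p \<union> ?s) ` sfree_partitions ?V \<subseteq> {p \<in> set_partitions n. fixed_points n p = S}"
    proof clarify
      fix p assume "p \<in> sfree_partitions ?V"
      then have p: "partition_on ?V p" "\<forall>B\<in>p. card B \<noteq> 1" by (auto simp: sfree_partitions_def)
      have "partition_on {1..n} (p \<union> ?s)"
      proof (rule partition_onI)
        have un: "\<Union>p = ?V" using partition_onD1[OF p(1)] by (rule sym)
        have "\<Union>(p \<union> ?s) = ?V \<union> S" unfolding Union_Un_distrib un by simp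
        then show "\<Union>(p \<union> ?s) = {1..n}" using assms by blast
        show "{} \<notin> p \<union> ?s" using partition_onD3[OF p(1)] by auto
        have block: "B \<inter> S = {}" if "B \<in> p" for B using un that by blast
        show "disjnt B C" if "B \<in> p \<union> ?s" "C \<in> p \<union> ?s" "B \<noteq> C" for B C
        proof (cases "B \<in> p \<and> C \<in> p")
          case True
          then show ?thesis using partition_onD2[OF p(1)] that(3) by (simp add: disjoint_def disjnt_def)
        next
          case False
          then show ?thesis using that block by (auto simp: disjnt_def)
        qed
      qed
      moreover have "fixed_points n (p \<union> ?s) = S"
        using p(2) assms by (auto simp: fixed_points_def)
      ultimately show "p \<union> ?s \<in> set_partitions n \<and> fixed_points n (p \<union> ?s) = S"
        by (simp add: set_partitions_def)
    qed
    show "(\<lambda>p. p - ?s) ` {p \<in> set_partitions n. fixed_points n p = S} \<subseteq> sfree_partitions ?V"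
    proof clarify
      fix p assume p: "p \<in> set_partitions n" "S = fixed_points n p"
      then have part: "partition_on {1..n} p" by (simp add: set_partitions_def)
      have "\<Union>(p - ?s) = ?V"
      proof
        show "\<Union>(p - ?s) \<subseteq> ?V"
        proof clarify
          fix x B assume B: "B \<in> p" "B \<notin> ?s" "x \<in> B"
          then have "x \<in> {1..n}" using partition_onD1[OF part] by blast
          moreover have "x \<notin> S"
          proof
            assume "x \<in> S"
            then have "B = {x}" using partition_on_unique_block[OF part B(1) _ B(3), of "{x}"] p(2)
              by (auto simp: fixed_points_def)
            then show False using B(2) \<open>x \<in> S\<close> by blast
          qed
          ultimately show "x \<in> ?V" by blast
        qed
        show "?V \<subseteq> \<Union>(p - ?s)" using partition_onD1[OF part] by blast
      qed
      moreover have "disjoint (p - ?s)" "{} \<notin> p - ?s"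
        using part by (auto simp: partition_on_def disjoint_def)
      moreover have "card B \<noteq> 1" if "B \<in> p - ?s" for B
      proof
        assume "card B = 1"
        then obtain x where "B = {x}" by (rule card_1_singletonE)
        moreover from this have "x \<in> {1..n}" using that partition_onD1[OF part] by blast
        ultimately show False using that p(2) by (auto simp: fixed_points_def)
      qed
      ultimately show "p - (\<lambda>i. {i}) ` fixed_points n p \<in> sfree_partitions ({1..n} - fixed_points n p)"
        unfolding p(2) by (simp add: sfree_partitions_def partition_on_def)
    qed
  qed
  then have "card {p \<in> set_partitions n. fixed_points n p = S} = card (sfree_partitions ?V)"
    by (simp add: bij_betw_same_card)
  also have "\<dots> = sfree (n - card S)"
    using assms by (subst card_sfree_partitions) (auto simp: card_Diff_subset finite_subset)
  finally show ?thesis .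
qed

lemma finite_set_partitions: "finite (set_partitions n)"
  unfolding set_partitions_def by (rule finitely_many_partition_on) simp

lemma fixed_points_subset: "fixed_points n p \<subseteq> {1..n}"
  by (auto simp: fixed_points_def)

lemma card_partitions_family:
  assumes "H \<subseteq> Pow {1..n}"
  shows "card {p \<in> set_partitions n. fixed_points n p \<in> H} = family_weight n 0 H"
proof -
  have fin: "finite H" using assms finite_subset by blast
  have "{p \<in> set_partitions n. fixed_points n p \<in> H} = (\<Union>S\<in>H. {p \<in> set_partitions n. fixed_points n p = S})"
    by auto
  also have "card \<dots> = (\<Sum>S\<in>H. card {p \<in> set_partitions n. fixed_points n p = S})"
    using fin finite_set_partitions by (intro card_UN_disjoint) auto
  also have "\<dots> = (\<Sum>S\<in>H. sfree (n - card S))"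
    using assms by (intro sum.cong refl card_partitions_fixed_points) auto
  finally show ?thesis by (simp add: family_weight_def)
qed

lemma family_weight_cylinder:
  assumes "K \<subseteq> Pow {1..m}"
  shows "family_weight (m + d) q {S. S \<subseteq> {1..m + d} \<and> {1..m} \<inter> S \<in> K} = family_weight m (q + d) K"
proof (induction d arbitrary: q)
  case 0
  have "{S. S \<subseteq> {1..m} \<and> {1..m} \<inter> S \<in> K} = K"
    using assms by (auto simp: Int_absorb1)
  then show ?case by simp
next
  case (Suc d)
  let ?K = "{S. S \<subseteq> {1..m + d} \<and> {1..m} \<inter> S \<in> K}"
  have "{S. S \<subseteq> {1..m + Suc d} \<and> {1..m} \<inter> S \<in> K} = ?K \<union> insert (Suc (m + d)) ` ?K"
  proof
    show "{S. S \<subseteq> {1..m + Suc d} \<and> {1..m} \<inter> S \<in> K} \<subseteq> ?K \<union> insert (Suc (m + d)) ` ?K"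
    proof
      fix S assume "S \<in> {S. S \<subseteq> {1..m + Suc d} \<and> {1..m} \<inter> S \<in> K}"
      then have S: "S \<subseteq> {1..m + Suc d}" "{1..m} \<inter> S \<in> K" by auto
      have "S - {Suc (m + d)} \<subseteq> {1..m + d}" "{1..m} \<inter> (S - {Suc (m + d)}) = {1..m} \<inter> S"
        using S(1) by (auto simp: le_Suc_eq)
      then have K: "S - {Suc (m + d)} \<in> ?K" using S(2) by simp
      show "S \<in> ?K \<union> insert (Suc (m + d)) ` ?K"
      proof (cases "Suc (m + d) \<in> S")
        case True
        then have "S = insert (Suc (m + d)) (S - {Suc (m + d)})" by (rule insert_Diff[symmetric])
        then show ?thesis using K by (rule UnI2[OF image_eqI])
      qed (use K in simp)
    qed
    have "{1..m} \<inter> insert (Suc (m + d)) S = {1..m} \<inter> S" for S by auto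
    then show "?K \<union> insert (Suc (m + d)) ` ?K \<subseteq> {S. S \<subseteq> {1..m + Suc d} \<and> {1..m} \<inter> S \<in> K}"
      by (auto simp: atLeastAtMostSuc_conv)
  qed
  then have "family_weight (m + Suc d) q {S. S \<subseteq> {1..m + Suc d} \<and> {1..m} \<inter> S \<in> K} = family_weight (m + d) (Suc q) ?K"
    using family_weight_Suc[of ?K "m + d" q] by auto
  then show ?case using Suc.IH[of "Suc q"] by simp
qed

lemma card_star_family:
  assumes "t + 2 * r \<le> n"
  shows "card {p \<in> set_partitions n. t + r \<le> card ({1..t + 2 * r} \<inter> fixed_points n p)} = frankl_weight t r (n - t - 2 * r)"
proof -
  define m where "m = t + 2 * r"
  define K where "K = {S. S \<subseteq> {1..m} \<and> m - r \<le> card S}"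
  let ?H = "{S. S \<subseteq> {1..m + (n - m)} \<and> {1..m} \<inter> S \<in> K}"
  have m: "m + (n - m) = n" "m - r = t + r" using assms by (simp_all add: m_def)
  have "{p \<in> set_partitions n. t + r \<le> card ({1..m} \<inter> fixed_points n p)} = {p \<in> set_partitions n. fixed_points n p \<in> ?H}"
    using fixed_points_subset unfolding m K_def by auto
  also have "card \<dots> = family_weight n 0 ?H"
    using m by (intro card_partitions_family) auto
  also have "\<dots> = family_weight m (n - m) K"
  proof -
    have "K \<subseteq> Pow {1..m}" by (auto simp: K_def)
    from family_weight_cylinder[OF this, of "n - m" 0] show ?thesis
      unfolding m(1) by (simp only: add_0)
  qed
  also have "\<dots> = (\<Sum>a\<le>r. (m choose a) * semifree a (n - m))"
    unfolding K_def by (rule family_weight_large_sets) (simp add: m_def)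
  finally show ?thesis by (simp add: frankl_weight_def m_def)
qed

section \<open>Splitting a point off its block\<close>

definition split_off :: "'a \<Rightarrow> 'a set set \<Rightarrow> 'a set set" where
  "split_off i p = insert {i} ((\<lambda>B. B - {i}) ` p - {{}})"

definition together :: "'a \<Rightarrow> 'a \<Rightarrow> 'a set set \<Rightarrow> bool" where
  "together i j p \<longleftrightarrow> (\<exists>B\<in>p. i \<in> B \<and> j \<in> B)"

lemma split_off_eq:
  assumes "partition_on V p" "B \<in> p" "i \<in> B" "j \<in> B" "i \<noteq> j"
  shows "split_off i p = insert {i} (insert (B - {i}) (p - {B}))"
proof -
  have other: "C - {i} = C" "C \<noteq> {}" if "C \<in> p - {B}" for C
    using that assms partition_on_unique_block[OF assms(1,2), of C i] partition_onD3[OF assms(1)] by auto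
  have "(\<lambda>B. B - {i}) ` p = insert (B - {i}) ((\<lambda>B. B - {i}) ` (p - {B}))"
    using assms(2) by blast
  also have "(\<lambda>B. B - {i}) ` (p - {B}) = (\<lambda>B. B) ` (p - {B})"
    by (intro image_cong refl other(1))
  finally have eq: "(\<lambda>B. B - {i}) ` p = insert (B - {i}) (p - {B})"
    by (simp only: image_ident)
  have "{} \<notin> insert (B - {i}) (p - {B})"
    using other(2) assms(4,5) by blast
  then show ?thesis unfolding split_off_def eq by simp
qed

lemma partition_on_split_off:
  assumes "partition_on V p" "i \<in> V"
  shows "partition_on V (split_off i p)"
proof -
  have 1: "partition_on (V - {i}) ((\<lambda>B. B - {i}) ` p - {{}})"
    using partition_on_transform[OF assms(1), of "\<lambda>B. B - {i}"] by (auto simp: disjnt_def)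
  have disj: "disjnt {i} (\<Union>((\<lambda>B. B - {i}) ` p - {{}}))"
    by (auto simp: disjnt_def)
  show ?thesis
    unfolding split_off_def partition_on_insert[OF disj] using 1 assms(2) by blast
qed

lemma new_blocks_notin:
  assumes "partition_on V p" "B \<in> p" "i \<in> B" "j \<in> B" "i \<noteq> j"
  shows "{i} \<notin> p" "B - {i} \<notin> p"
  using assms partition_on_unique_block[OF assms(1,2), of "{i}" i]
    partition_on_unique_block[OF assms(1,2), of "B - {i}" j] by auto

lemma card_split_off:
  assumes "finite V" "partition_on V p" "together i j p" "i \<noteq> j"
  shows "card (split_off i p) = Suc (card p)"
proof -
  obtain B where B: "B \<in> p" "i \<in> B" "j \<in> B" using assms(3) by (auto simp: together_def)
  have "finite p" using finite_elements assms by blast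
  moreover have "{i} \<noteq> B - {i}" using B assms(4) by blast
  ultimately show ?thesis
    unfolding split_off_eq[OF assms(2) B assms(4)]
    using new_blocks_notin[OF assms(2) B assms(4)] card_Suc_Diff1[OF _ B(1)] by simp
qed

text \<open>The companion \<open>j\<close> marks the block to which \<open>i\<close> has to return,
  so the splitting can be undone.\<close>

lemma split_off_inj:
  assumes p: "partition_on V p" "together i j p" and q: "partition_on V q" "together i j q" and "i \<noteq> j"
    and eq: "split_off i p = split_off i q"
  shows "p = q"
proof -
  obtain B where B: "B \<in> p" "i \<in> B" "j \<in> B" using p(2) by (auto simp: together_def)
  obtain C where C: "C \<in> q" "i \<in> C" "j \<in> C" using q(2) by (auto simp: together_def)
  note sp = split_off_eq[OF p(1) B assms(5)] and sq = split_off_eq[OF q(1) C assms(5)]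
  have "i \<in> V" using p(1) B partition_onD1 by blast
  then have part: "partition_on V (split_off i p)" by (rule partition_on_split_off[OF p(1)])
  have "B - {i} = C - {i}"
  proof (rule partition_on_unique_block[OF part, of _ _ j])
    show "B - {i} \<in> split_off i p" by (simp add: sp)
    show "C - {i} \<in> split_off i p" by (simp add: eq sq)
  qed (use B C assms(5) in auto)
  then have "B = C" using B C by blast
  moreover have "p = insert B (split_off i p - {{i}, B - {i}})"
    unfolding sp using B(1) new_blocks_notin[OF p(1) B assms(5)] by auto
  moreover have "q = insert C (split_off i q - {{i}, C - {i}})"
    unfolding sq using C(1) new_blocks_notin[OF q(1) C assms(5)] by auto
  ultimately show ?thesis using eq by metis
qed

text \<open>At most one common block contains \<open>i\<close>; if it is lost, the new common block
  \<open>{i}\<close> makes up for it.\<close>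

lemma split_off_both:
  assumes "finite V" and p: "partition_on V p" "together i j p" and q: "partition_on V q" "together i j q" and "i \<noteq> j"
  shows "card (p \<inter> q) \<le> card (split_off i p \<inter> split_off i q)"
proof -
  obtain B where B: "B \<in> p" "i \<in> B" "j \<in> B" using p(2) by (auto simp: together_def)
  obtain C where C: "C \<in> q" "i \<in> C" "j \<in> C" using q(2) by (auto simp: together_def)
  note sp = split_off_eq[OF p(1) B assms(6)] and sq = split_off_eq[OF q(1) C assms(6)]
  let ?I = "(p - {B}) \<inter> (q - {C})"
  have "finite p" "finite q" using finite_elements assms by blast+
  have "p \<inter> q \<subseteq> insert B ?I"
    using partition_on_unique_block[OF p(1) B(1), of C i] B C by auto
  then have "card (p \<inter> q) \<le> card (insert B ?I)"
    using \<open>finite p\<close> by (intro card_mono) auto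
  also have "\<dots> \<le> Suc (card ?I)" using \<open>finite p\<close> by (simp add: card_insert_if)
  also have "\<dots> = card (insert {i} ?I)"
    using \<open>finite p\<close> new_blocks_notin(1)[OF p(1) B assms(6)] by simp
  also have "\<dots> \<le> card (split_off i p \<inter> split_off i q)"
    unfolding sp sq using \<open>finite p\<close> by (intro card_mono) auto
  finally show ?thesis .
qed

lemma split_off_left:
  assumes "finite V" and p: "partition_on V p" "together i j p" and q: "partition_on V q" "\<not> together i j q" and "i \<noteq> j"
  shows "card (p \<inter> q) \<le> card (split_off i p \<inter> q)"
proof -
  obtain B where B: "B \<in> p" "i \<in> B" "j \<in> B" using p(2) by (auto simp: together_def)
  have "B \<notin> q" using q(2) B by (auto simp: together_def)
  moreover have "finite q" using finite_elements assms by blast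
  ultimately show ?thesis
    unfolding split_off_eq[OF p(1) B assms(6)] by (intro card_mono) auto
qed

text \<open>For the case that \<open>q\<close> stays because \<open>split_off i q\<close> is already
  in the family. The new blocks of the split \<open>q\<close> are not in \<open>p\<close>, and
  \<open>B\<close> is not among its old ones, so every block counted on the left is common to the
  split \<open>p\<close> and to \<open>q\<close>.\<close>

lemma split_off_swap:
  assumes "finite V" and p: "partition_on V p" "together i j p" and q: "partition_on V q" "together i j q" and "i \<noteq> j"
  shows "card (p \<inter> split_off i q) \<le> card (split_off i p \<inter> q)"
proof -
  obtain B where B: "B \<in> p" "i \<in> B" "j \<in> B" using p(2) by (auto simp: together_def)
  obtain C where C: "C \<in> q" "i \<in> C" "j \<in> C" using q(2) by (auto simp: together_def)
  have "C - {i} \<notin> p"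
    using partition_on_unique_block[OF p(1) B(1), of "C - {i}" j] B C assms(6) by auto
  moreover have "B \<notin> q - {C}"
    using partition_on_unique_block[OF q(1) C(1), of B i] B C by auto
  moreover have "finite q" using finite_elements assms by blast
  ultimately show ?thesis
    unfolding split_off_eq[OF p(1) B assms(6)] split_off_eq[OF q(1) C assms(6)]
    using new_blocks_notin(1)[OF p(1) B assms(6)] by (intro card_mono) auto
qed

definition split_compress :: "'a \<Rightarrow> 'a \<Rightarrow> 'a set set set \<Rightarrow> 'a set set \<Rightarrow> 'a set set" where
  "split_compress i j A p = (if together i j p \<and> split_off i p \<notin> A then split_off i p else p)"

lemma exists_split_closed:
  assumes "A0 \<subseteq> set_partitions n" "t_intersecting t A0"
  obtains A where "A \<subseteq> set_partitions n" "t_intersecting t A" "card A = card A0"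
    "\<And>p i j. p \<in> A \<Longrightarrow> together i j p \<Longrightarrow> i \<noteq> j \<Longrightarrow> split_off i p \<in> A"
proof -
  define X where "X = {A. A \<subseteq> set_partitions n \<and> t_intersecting t A \<and> card A = card A0}"
  \<comment> \<open>Each splitting adds one block, so a family with the most blocks in total is
    closed under splitting.\<close>
  define blocks :: "nat set set set \<Rightarrow> nat" where "blocks A = (\<Sum>p\<in>A. card p)" for A
  have "finite X" by (rule finite_subset[of _ "Pow (set_partitions n)"]) (auto simp: X_def finite_set_partitions)
  moreover have "A0 \<in> X" using assms by (simp add: X_def)
  ultimately have "Max (blocks ` X) \<in> blocks ` X" by (intro Max_in) auto
  then obtain A where A: "A \<in> X" and "blocks A = Max (blocks ` X)" by auto
  then have max: "blocks A' \<le> blocks A" if "A' \<in> X" for A'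
    using that \<open>finite X\<close> by (auto intro: Max_ge)
  have sub: "A \<subseteq> set_partitions n" and int: "t_intersecting t A" and card: "card A = card A0"
    using A by (auto simp: X_def)
  have finA: "finite A" using sub finite_set_partitions finite_subset by blast
  have part: "partition_on {1..n} p" if "p \<in> A" for p using sub that by (auto simp: set_partitions_def)
  have "split_off i p \<in> A" if p: "p \<in> A" "together i j p" and ij: "i \<noteq> j" for p i j
  proof (rule ccontr)
    assume notin: "split_off i p \<notin> A"
    let ?c = "split_compress i j A"
    have inj: "inj_on ?c A"
    proof (rule inj_onI)
      fix p q assume "p \<in> A" "q \<in> A" "?c p = ?c q"
      then show "p = q"
        using split_off_inj[OF part _ part _ ij, of p q] by (auto simp: split_compress_def split: if_splits)
    qed
    have "?c q \<in> set_partitions n" if "q \<in> A" for q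
    proof (cases "together i j q")
      case True
      then have "i \<in> {1..n}" using part[OF that] partition_onD1 by (fastforce simp: together_def)
      then have "split_off i q \<in> set_partitions n"
        using partition_on_split_off[OF part[OF that]] by (simp add: set_partitions_def)
      then show ?thesis using sub that by (auto simp: split_compress_def)
    qed (use sub that in \<open>auto simp: split_compress_def\<close>)
    then have "?c ` A \<subseteq> set_partitions n" by blast
    moreover have "t_intersecting t (?c ` A)"
    proof -
      have one: "t \<le> card (?c q \<inter> ?c q')" if q: "q \<in> A" "q' \<in> A" "together i j q" "split_off i q \<notin> A" for q q'
      proof -
        have le: "t \<le> card (q \<inter> q')" using int q by (auto simp: t_intersecting_def)
        have cq: "?c q = split_off i q" using q by (simp add: split_compress_def)
        consider "\<not> together i j q'" | "together i j q'" "split_off i q' \<in> A"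
          | "together i j q'" "split_off i q' \<notin> A" by blast
        then show ?thesis
        proof cases
          case 1
          then show ?thesis
            using le split_off_left[OF _ part _ part, of q i j q'] q ij cq by (simp add: split_compress_def)
        next
          case 2
          then have "t \<le> card (q \<inter> split_off i q')" using int q by (auto simp: t_intersecting_def)
          then show ?thesis
            using split_off_swap[OF _ part _ part, of q i j q'] 2 q ij cq by (simp add: split_compress_def)
        next
          case 3
          then show ?thesis
            using le split_off_both[OF _ part _ part, of q i j q'] q ij cq by (simp add: split_compress_def)
        qed
      qed
      have "t \<le> card (?c q \<inter> ?c q')" if q: "q \<in> A" "q' \<in> A" for q q'
      proof -
        consider "together i j q" "split_off i q \<notin> A" | "together i j q'" "split_off i q' \<notin> A"
          | "?c q = q" "?c q' = q'" by (metis split_compress_def)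
        then show ?thesis
        proof cases
          case 3
          then show ?thesis using int q by (simp add: t_intersecting_def)
        qed (use one[of q q'] one[of q' q] q in \<open>auto simp: Int_commute\<close>)
      qed
      then show ?thesis by (auto simp: t_intersecting_def)
    qed
    moreover have "card (?c ` A) = card A0" using card_image[OF inj] card by simp
    ultimately have "?c ` A \<in> X" by (simp add: X_def)
    have csuc: "card (?c q) = Suc (card q)" if "q \<in> A" "together i j q" "split_off i q \<notin> A" for q
      using card_split_off[OF _ part, of q i j] that ij by (simp add: split_compress_def)
    have ceq: "?c q = q" if "\<not> (together i j q \<and> split_off i q \<notin> A)" for q
      using that by (auto simp: split_compress_def)
    have "blocks A < (\<Sum>q\<in>A. card (?c q))"
      unfolding blocks_def
    proof (rule sum_strict_mono_ex1[OF finA])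
      show "\<forall>q\<in>A. card q \<le> card (?c q)" using csuc ceq by (metis le_Suc_eq le_refl)
      show "\<exists>q\<in>A. card q < card (?c q)" using csuc p notin by (metis lessI)
    qed
    also have "\<dots> = blocks (?c ` A)" by (simp add: blocks_def sum.reindex[OF inj])
    finally show False using max[OF \<open>?c ` A \<in> X\<close>] by simp
  qed
  then show thesis using that sub int card by blast
qed

text \<open>Splitting a common block of at least two points in \<open>p\<close> alone stays in the
  family, removes just this block from the intersection and changes no common fixed point. In the
  end all common blocks are singletons.\<close>

lemma split_closed_fixed_points:
  assumes sub: "A \<subseteq> set_partitions n" and int: "t_intersecting t A"
    and closed: "\<And>p i j. p \<in> A \<Longrightarrow> together i j p \<Longrightarrow> i \<noteq> j \<Longrightarrow> split_off i p \<in> A"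
    and "p \<in> A" "q \<in> A"
  shows "t \<le> card (fixed_points n p \<inter> fixed_points n q)"
  using assms(4)
proof (induction "card (p \<inter> q)" arbitrary: p rule: less_induct)
  case less
  have p: "partition_on {1..n} p" and q: "partition_on {1..n} q"
    using sub less.prems assms(5) by (auto simp: set_partitions_def)
  have fin: "finite p" "finite q" using finite_elements p q by blast+
  have fix_Int: "fixed_points n p' \<inter> fixed_points n q = {i\<in>{1..n}. {i} \<in> p' \<inter> q}" for p'
    by (auto simp: fixed_points_def)
  show ?case
  proof (cases "\<exists>B\<in>p \<inter> q. card B \<noteq> 1")
    case True
    then obtain B where B: "B \<in> p" "B \<in> q" "card B \<noteq> 1" by blast
    then have "B \<noteq> {}" using partition_onD3[OF p] by blast
    then obtain i where i: "i \<in> B" by blast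
    have "B \<noteq> {i}" using B(3) by auto
    then obtain j where j: "j \<in> B" "i \<noteq> j" using i by blast
    have eq: "split_off i p \<inter> q = p \<inter> q - {B}"
      unfolding split_off_eq[OF p B(1) i j] using new_blocks_notin[OF q B(2) i j] by auto
    then have "card (split_off i p \<inter> q) < card (p \<inter> q)"
      using B fin by (metis IntI card_Diff1_less finite_Int)
    moreover have "split_off i p \<in> A"
      using closed[OF less.prems _ j(2)] B(1) i j by (auto simp: together_def)
    ultimately have "t \<le> card (fixed_points n (split_off i p) \<inter> fixed_points n q)"
      by (rule less.hyps)
    also have "fixed_points n (split_off i p) \<inter> fixed_points n q = fixed_points n p \<inter> fixed_points n q"
      unfolding fix_Int eq using \<open>B \<noteq> {i}\<close> B(3) by auto
    finally show ?thesis .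
  next
    case False
    have "p \<inter> q \<subseteq> (\<lambda>i. {i}) ` (fixed_points n p \<inter> fixed_points n q)"
    proof
      fix B assume B: "B \<in> p \<inter> q"
      then have "card B = 1" using False by blast
      then obtain i where "B = {i}" by (rule card_1_singletonE)
      moreover from this have "i \<in> {1..n}" using B partition_onD1[OF p] by blast
      ultimately show "B \<in> (\<lambda>i. {i}) ` (fixed_points n p \<inter> fixed_points n q)"
        using B by (auto simp: fixed_points_def)
    qed
    then have "card (p \<inter> q) \<le> card (fixed_points n p \<inter> fixed_points n q)"
      by (rule surj_card_le[rotated]) (simp add: fixed_points_def)
    moreover have "t \<le> card (p \<inter> q)" using int less.prems assms(5) by (simp add: t_intersecting_def)
    ultimately show ?thesis by linarith
  qed
qed

lemma t_intersecting_card_le: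
  assumes t: "1 \<le> t" "t \<le> n" and A: "A \<subseteq> set_partitions n" "t_intersecting t A"
  shows "\<exists>r\<le>(n - t) div 2. card A \<le> frankl_weight t r (n - t - 2 * r)"
proof -
  obtain A' where A': "A' \<subseteq> set_partitions n" "t_intersecting t A'" "card A' = card A"
    and closed: "\<And>p i j. p \<in> A' \<Longrightarrow> together i j p \<Longrightarrow> i \<noteq> j \<Longrightarrow> split_off i p \<in> A'"
    using exists_split_closed[OF A] by blast
  define H where "H = fixed_points n ` A'"
  have H: "H \<subseteq> Pow {1..n}" using fixed_points_subset by (auto simp: H_def)
  have "set_t_intersecting t H"
    using split_closed_fixed_points[OF A'(1,2) closed] by (auto simp: H_def set_t_intersecting_def)
  then have "\<exists>r\<le>(n - t) div 2. family_weight n (n - n) H \<le> frankl_weight t r (n - t - 2 * r)"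
    using t H by (intro family_weight_le) auto
  moreover have "card A \<le> family_weight n 0 H"
  proof -
    have "A' \<subseteq> {p \<in> set_partitions n. fixed_points n p \<in> H}" using A'(1) by (auto simp: H_def)
    then have "card A' \<le> card {p \<in> set_partitions n. fixed_points n p \<in> H}"
      using finite_set_partitions by (intro card_mono) auto
    then show ?thesis using card_partitions_family[OF H] A'(3) by simp
  qed
  ultimately show ?thesis by (metis diff_self_eq_0 le_trans)
qed

text \<open>Inclusion-exclusion: \<open>2 * (t + r) - (t + 2 * r) = t\<close>.\<close>

lemma star_family_t_intersecting:
  assumes "t + 2 * r \<le> n"
  shows "t_intersecting t {p \<in> set_partitions n. t + r \<le> card ({1..t + 2 * r} \<inter> fixed_points n p)}"
  unfolding t_intersecting_def
proof clarify
  fix p q assume p: "p \<in> set_partitions n" "t + r \<le> card ({1..t + 2 * r} \<inter> fixed_points n p)"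
    and q: "q \<in> set_partitions n" "t + r \<le> card ({1..t + 2 * r} \<inter> fixed_points n q)"
  let ?P = "{1..t + 2 * r} \<inter> fixed_points n p" and ?Q = "{1..t + 2 * r} \<inter> fixed_points n q"
  have "card (?P \<union> ?Q) \<le> t + 2 * r"
    using card_mono[of "{1..t + 2 * r}" "?P \<union> ?Q"] by simp
  then have "t \<le> card (?P \<inter> ?Q)"
    using card_Un_Int[of ?P ?Q] p(2) q(2) by simp
  also have "\<dots> \<le> card (p \<inter> q)"
  proof (rule card_inj_on_le[of "\<lambda>i. {i}"])
    show "finite (p \<inter> q)" using p(1) finite_elements[of "{1..n}" p] by (simp add: set_partitions_def)
  qed (auto simp: fixed_points_def)
  finally show "t \<le> card (p \<inter> q)" .
qed

theorem theorem1:
  fixes n t :: nat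
  assumes "1 \<le> t" and "t \<le> n"
  shows "max_intersecting n t =
    Max ((\<lambda>r. card {p \<in> set_partitions n. card ({1..t + 2 * r} \<inter> fixed_points n p) \<ge> t + r})
          ` {0..(n - t) div 2})"
proof -
  let ?F = "\<lambda>r. {p \<in> set_partitions n. card ({1..t + 2 * r} \<inter> fixed_points n p) \<ge> t + r}"
  let ?X = "{card \<A> | \<A>. \<A> \<subseteq> set_partitions n \<and> t_intersecting t \<A>}"
  have r_le: "t + 2 * r \<le> n" if "r \<in> {0..(n - t) div 2}" for r
    using that assms by auto
  have "?X \<subseteq> {..card (set_partitions n)}"
    using card_mono[OF finite_set_partitions] by auto
  then have fin: "finite ?X" using finite_subset by blast
  have "card {} \<in> ?X" by (rule CollectI, rule exI[of _ "{}"]) (simp add: t_intersecting_def)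
  then have ne: "?X \<noteq> {}" by blast
  show ?thesis
    unfolding max_intersecting_def
  proof (rule antisym)
    show "Max ?X \<le> Max ((\<lambda>r. card (?F r)) ` {0..(n - t) div 2})"
    proof (rule Max.boundedI[OF fin ne])
      fix x assume "x \<in> ?X"
      then obtain A where A: "x = card A" "A \<subseteq> set_partitions n" "t_intersecting t A" by blast
      obtain r where r: "r \<le> (n - t) div 2" "x \<le> frankl_weight t r (n - t - 2 * r)"
        using t_intersecting_card_le[OF assms A(2,3)] A(1) by blast
      then have "x \<le> card (?F r)" using card_star_family r_le by simp
      also have "\<dots> \<le> Max ((\<lambda>r. card (?F r)) ` {0..(n - t) div 2})"
        using r by (intro Max_ge) auto
      finally show "x \<le> Max ((\<lambda>r. card (?F r)) ` {0..(n - t) div 2})" .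
    qed
    show "Max ((\<lambda>r. card (?F r)) ` {0..(n - t) div 2}) \<le> Max ?X"
    proof (rule Max.boundedI)
      fix x assume "x \<in> (\<lambda>r. card (?F r)) ` {0..(n - t) div 2}"
      then obtain r where r: "r \<in> {0..(n - t) div 2}" "x = card (?F r)" by blast
      have "t_intersecting t (?F r)" by (rule star_family_t_intersecting[OF r_le[OF r(1)]])
      then have "x \<in> ?X" using r(2) by blast
      then show "x \<le> Max ?X" by (rule Max_ge[OF fin])
    qed simp_all
  qed
qed

end
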